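(* Let $\Omega\subset\mathbb{C}$ be a domain and let $(K_m)_{m\ge1}$ be an exhausting family of compact subsets of $\Omega$ such that every $K_m$ is the closure of a domain bounded by a finite number of disjoint Jordan curves. For each $m$ let $A_m=\{z_{1,m},\ldots,z_{N_m,m}\}$ be a set containing exactly one point from each bounded component of $K_m^c=\mathbb{C}\setminus K_m$, and let $A=\bigcup_{m=1}^\infty A_m$. Consider the space $H(\Omega)$ endowed with the topology of uniform convergence on compacta. Then the "rational Dirichlet" functions of the form $$R(s)=P_0(s)+\sum_{j=1}^{N}P_j\left(\frac{1}{s-z_j}\right),$$ where $N\in\mathbb{N}$, $z_j\in A$ and $P_j(s)=\sum_{n=1}^{M_j}a_{n,j}\frac{1}{n^s}$ ($j=0,\ldots,N$), are dense in $H(\Omega)$.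
   Context: $H(\Omega)$ denotes the space of holomorphic functions on $\Omega$. A Dirichlet polynomial is a function of the form $P(s)=\sum_{n=1}^{M}a_n\frac{1}{n^s}$ with $M\in\mathbb{N}$ and $a_n\in\mathbb{C}$; thus each $P_j$ in the claim is a Dirichlet polynomial. "Exhausting family" means that the $K_m$ are increasing and every compact subset of $\Omega$ is contained in some $K_m$; every domain $\Omega\subset\mathbb{C}$ has such a family of the kind described in the claim.
   Formalization: Points of A may lie in Ω, and then R is not in H(Ω) (e.g. Ω=ℂ∖{0}, all z_j≠0). Density in H(Ω) is therefore stated when A∩Ω=∅; in general, every f in H(Ω) is approximated uniformly on each compact L⊂Ω by such R with all z_j in A∖L. *)

theory Defs
  imports "HOL-Complex_Analysis.Complex_Analysis"
begin

definition complex_domain :: "complex set \<Rightarrow> bool" where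
  "complex_domain D \<longleftrightarrow> open D \<and> connected D \<and> D \<noteq> {}"

definition jordan_curve :: "complex set \<Rightarrow> bool" where
  "jordan_curve J \<longleftrightarrow>
     (\<exists>\<gamma>. simple_path \<gamma> \<and> pathfinish \<gamma> = pathstart \<gamma> \<and> J = path_image \<gamma>)"

definition jordan_bounded_domain :: "complex set \<Rightarrow> bool" where
  "jordan_bounded_domain D \<longleftrightarrow> complex_domain D \<and>
     (\<exists>\<J>. finite \<J> \<and> (\<forall>J\<in>\<J>. jordan_curve J) \<and> pairwise disjnt \<J> \<and> frontier D = \<Union>\<J>)"

text \<open>The families below are indexed from 1; the value at 0 plays no role.\<close>

definition exhausting_family :: "complex set \<Rightarrow> (nat \<Rightarrow> complex set) \<Rightarrow> bool" where
  "exhausting_family \<Omega> K \<longleftrightarrow>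
     (\<forall>m\<ge>1. compact (K m) \<and> K m \<subseteq> \<Omega> \<and> K m \<subseteq> K (Suc m)) \<and>
     (\<forall>L. compact L \<and> L \<subseteq> \<Omega> \<longrightarrow> (\<exists>m\<ge>1. L \<subseteq> K m))"

definition hole_representatives :: "complex set \<Rightarrow> complex set \<Rightarrow> bool" where
  "hole_representatives K A \<longleftrightarrow>
     A \<subseteq> \<Union>{C \<in> components (- K). bounded C} \<and>
     (\<forall>C\<in>components (- K). bounded C \<longrightarrow> (\<exists>!z. z \<in> A \<inter> C))"

definition dirichlet_polynomial :: "(complex \<Rightarrow> complex) \<Rightarrow> bool" where
  "dirichlet_polynomial P \<longleftrightarrow>
     (\<exists>(M::nat) (a::nat \<Rightarrow> complex). P = (\<lambda>s. \<Sum>n=1..M. a n * (1 / of_nat n powr s)))"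

text \<open>At a point \<open>z j\<close> the value of such a function is only an artefact of \<open>1 / 0 = 0\<close>.\<close>

definition rational_dirichlet :: "complex set \<Rightarrow> (complex \<Rightarrow> complex) set" where
  "rational_dirichlet A =
     {R. \<exists>(N::nat) (z::nat \<Rightarrow> complex) (P::nat \<Rightarrow> complex \<Rightarrow> complex).
           (\<forall>j\<in>{1..N}. z j \<in> A) \<and> (\<forall>j\<in>{0..N}. dirichlet_polynomial (P j)) \<and>
           R = (\<lambda>s. P 0 s + (\<Sum>j=1..N. P j (1 / (s - z j))))}"

text \<open>
  Elements of \<open>H(\<Omega>)\<close> are functions on \<open>\<Omega>\<close>, represented as total functions that are
  \<open>undefined\<close> off \<open>\<Omega>\<close>, so that functions agreeing on \<open>\<Omega>\<close> are equal.
\<close>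

definition holomorphic_functions :: "complex set \<Rightarrow> (complex \<Rightarrow> complex) set" where
  "holomorphic_functions \<Omega> = {f \<in> extensional \<Omega>. f holomorphic_on \<Omega>}"

definition holomorphic_topology :: "complex set \<Rightarrow> (complex \<Rightarrow> complex) topology" where
  "holomorphic_topology \<Omega> = topology (\<lambda>U. U \<subseteq> holomorphic_functions \<Omega> \<and>
     (\<forall>f\<in>U. \<exists>L \<epsilon>. compact L \<and> L \<subseteq> \<Omega> \<and> 0 < \<epsilon> \<and>
        {g \<in> holomorphic_functions \<Omega>. \<forall>s\<in>L. dist (g s) (f s) < \<epsilon>} \<subseteq> U))"

lemma openin_holomorphic_topology:
  "openin (holomorphic_topology \<Omega>) U \<longleftrightarrow> U \<subseteq> holomorphic_functions \<Omega> \<and>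
     (\<forall>f\<in>U. \<exists>L \<epsilon>. compact L \<and> L \<subseteq> \<Omega> \<and> 0 < \<epsilon> \<and>
        {g \<in> holomorphic_functions \<Omega>. \<forall>s\<in>L. dist (g s) (f s) < \<epsilon>} \<subseteq> U)"
proof -
  let ?B = "\<lambda>f L \<epsilon>. {g \<in> holomorphic_functions \<Omega>. \<forall>s\<in>L. dist (g s) (f s) < \<epsilon>}"
  let ?P = "\<lambda>U f. \<exists>L \<epsilon>. compact L \<and> L \<subseteq> \<Omega> \<and> 0 < \<epsilon> \<and> ?B f L \<epsilon> \<subseteq> U"
  have "istopology (\<lambda>U. U \<subseteq> holomorphic_functions \<Omega> \<and> (\<forall>f\<in>U. ?P U f))"
    unfolding istopology_def
  proof (intro conjI allI impI)
    fix S T assume S: "S \<subseteq> holomorphic_functions \<Omega> \<and> (\<forall>f\<in>S. ?P S f)"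
      and T: "T \<subseteq> holomorphic_functions \<Omega> \<and> (\<forall>f\<in>T. ?P T f)"
    show "S \<inter> T \<subseteq> holomorphic_functions \<Omega>" using S by blast
    show "\<forall>f\<in>S \<inter> T. ?P (S \<inter> T) f"
    proof
      fix f assume f: "f \<in> S \<inter> T"
      then have "?P S f" "?P T f" using S T by blast+
      then obtain L \<epsilon> L' \<epsilon>' where
        *: "compact L" "L \<subseteq> \<Omega>" "0 < \<epsilon>" "?B f L \<epsilon> \<subseteq> S"
           "compact L'" "L' \<subseteq> \<Omega>" "0 < \<epsilon>'" "?B f L' \<epsilon>' \<subseteq> T"
        by (elim exE conjE)
      have "?B f (L \<union> L') (min \<epsilon> \<epsilon>') \<subseteq> ?B f L \<epsilon> \<inter> ?B f L' \<epsilon>'" by auto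
      then have "?B f (L \<union> L') (min \<epsilon> \<epsilon>') \<subseteq> S \<inter> T" using *(4,8) by blast
      moreover have "compact (L \<union> L')" "L \<union> L' \<subseteq> \<Omega>" "0 < min \<epsilon> \<epsilon>'"
        using * by (auto intro: compact_Un)
      ultimately show "?P (S \<inter> T) f" by blast
    qed
  next
    fix \<K> assume \<K>: "\<forall>U\<in>\<K>. U \<subseteq> holomorphic_functions \<Omega> \<and> (\<forall>f\<in>U. ?P U f)"
    then show "\<Union>\<K> \<subseteq> holomorphic_functions \<Omega>" by blast
    show "\<forall>f\<in>\<Union>\<K>. ?P (\<Union>\<K>) f"
    proof
      fix f assume "f \<in> \<Union>\<K>"
      then obtain U where U: "U \<in> \<K>" "f \<in> U" by blast
      with \<K> have "?P U f" by blast
      then show "?P (\<Union>\<K>) f" using U(1) by (meson Union_upper subset_trans)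
    qed
  qed
  then show ?thesis
    by (simp add: holomorphic_topology_def topology_inverse')
qed

lemma topspace_holomorphic_topology [simp]:
  "topspace (holomorphic_topology \<Omega>) = holomorphic_functions \<Omega>"
proof -
  have "openin (holomorphic_topology \<Omega>) (holomorphic_functions \<Omega>)"
    unfolding openin_holomorphic_topology
    by (intro conjI ballI exI[of _ "{}"] exI[of _ "1::real"]) auto
  then show ?thesis
    by (metis openin_holomorphic_topology openin_subset openin_topspace subset_antisym)
qed

lemma in_closure_of_holomorphic_topology:
  "f \<in> holomorphic_topology \<Omega> closure_of S \<longleftrightarrow> f \<in> holomorphic_functions \<Omega> \<and>
     (\<forall>L \<epsilon>. compact L \<and> L \<subseteq> \<Omega> \<and> 0 < \<epsilon> \<longrightarrow>
        (\<exists>g\<in>S \<inter> holomorphic_functions \<Omega>. \<forall>s\<in>L. dist (g s) (f s) < \<epsilon>))"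
  (is "?lhs \<longleftrightarrow> ?rhs")
proof
  assume lhs: ?lhs
  then have f: "f \<in> holomorphic_functions \<Omega>" by (simp add: in_closure_of)
  have "\<exists>g\<in>S \<inter> holomorphic_functions \<Omega>. \<forall>s\<in>L. dist (g s) (f s) < \<epsilon>"
    if L: "compact L" "L \<subseteq> \<Omega>" "0 < \<epsilon>" for L \<epsilon>
  proof -
    define U where "U = {g \<in> holomorphic_functions \<Omega>. \<exists>\<delta><\<epsilon>. \<forall>s\<in>L. dist (g s) (f s) \<le> \<delta>}"
    have "openin (holomorphic_topology \<Omega>) U"
      unfolding openin_holomorphic_topology
    proof (intro conjI ballI)
      fix g assume "g \<in> U"
      then obtain \<delta> where \<delta>: "\<delta> < \<epsilon>" "\<forall>s\<in>L. dist (g s) (f s) \<le> \<delta>"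
        by (auto simp: U_def)
      have "h \<in> U" if h: "h \<in> holomorphic_functions \<Omega>"
        "\<forall>s\<in>L. dist (h s) (g s) < (\<epsilon> - \<delta>) / 2" for h
      proof -
        have "dist (h s) (f s) \<le> (\<epsilon> + \<delta>) / 2" if s: "s \<in> L" for s
        proof -
          have "dist (h s) (f s) \<le> dist (h s) (g s) + dist (g s) (f s)"
            by (rule dist_triangle)
          also have "\<dots> \<le> (\<epsilon> - \<delta>) / 2 + \<delta>"
            using h(2) \<delta>(2) s by (intro add_mono) (blast intro: less_imp_le)+
          finally show ?thesis by (simp add: field_simps)
        qed
        moreover have "(\<epsilon> + \<delta>) / 2 < \<epsilon>" using \<delta>(1) by simp
        ultimately show ?thesis using h(1) unfolding U_def by blast
      qed
      then show "\<exists>L \<epsilon>. compact L \<and> L \<subseteq> \<Omega> \<and> 0 < \<epsilon> \<and>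
          {h \<in> holomorphic_functions \<Omega>. \<forall>s\<in>L. dist (h s) (g s) < \<epsilon>} \<subseteq> U"
        using L \<delta>(1) by (intro exI[of _ L] exI[of _ "(\<epsilon> - \<delta>) / 2"]) auto
    qed (auto simp: U_def)
    moreover have "f \<in> U" using f L(3) by (auto simp: U_def intro!: exI[of _ 0])
    ultimately obtain g where "g \<in> S" "g \<in> U" using lhs by (auto simp: in_closure_of)
    then have "g \<in> S \<inter> holomorphic_functions \<Omega>" "\<forall>s\<in>L. dist (g s) (f s) < \<epsilon>"
      unfolding U_def using le_less_trans by blast+
    then show ?thesis by blast
  qed
  with f show ?rhs by blast
next
  assume rhs: ?rhs
  show ?lhs
    unfolding in_closure_of
  proof (intro conjI allI impI)
    fix T assume "f \<in> T \<and> openin (holomorphic_topology \<Omega>) T"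
    then obtain L \<epsilon> where L: "compact L \<and> L \<subseteq> \<Omega> \<and> 0 < \<epsilon>"
      "{g \<in> holomorphic_functions \<Omega>. \<forall>s\<in>L. dist (g s) (f s) < \<epsilon>} \<subseteq> T"
      unfolding openin_holomorphic_topology by meson
    with rhs obtain g where "g \<in> S \<inter> holomorphic_functions \<Omega>" "\<forall>s\<in>L. dist (g s) (f s) < \<epsilon>"
      by meson
    with L show "\<exists>y. y \<in> S \<and> y \<in> T" by blast
  qed (use rhs in auto)
qed

end

theory Submission
  imports Defs "HOL-Real_Asymp.Real_Asymp"
begin

text \<open>
  The theorem is Runge's theorem in which Dirichlet polynomials take the place of polynomials. It rests
  on two facts that have little to do with each other.

  First, on every disc the identity function is a uniform limit of Dirichlet polynomials
  (\<open>identity_approx_dirichlet\<close>). The contour integral of \<open>exp (- (w * s))\<close> divided by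
  \<open>w\<^sup>2 * (w - ln 2) * \<dots> * (w - ln N)\<close> over a large circle is, by residues, a multiple of \<open>s\<close> plus a constant
  plus a combination of \<open>exp (- (ln n * s))\<close>, that is, of \<open>1 / n powr s\<close>, for \<open>2 \<le> n \<le> N\<close>. On a circle of
  radius \<open>4 * ln N\<close> the integral is tiny compared with that multiple, because there are exponentially
  many nodes within a radius of only \<open>ln N\<close>. As Dirichlet polynomials form an algebra, every polynomial is then a uniform limit of Dirichlet
  polynomials on every disc, and every polynomial in a bounded function \<open>\<phi>\<close> is a uniform limit of
  Dirichlet polynomials in \<open>\<phi>\<close> (\<open>polynomials_in_subset_dirichlet\<close>). This is applied to \<open>\<phi> s = s\<close> and
  \<open>\<phi> s = 1 / (s - a)\<close>.

  Second, there is Runge's theorem itself. A grid argument expresses \<open>f\<close> on a compact set \<open>K\<close> by Cauchy integrals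
  over finitely many segments that avoid \<open>K\<close> (\<open>Cauchy_formula_compact\<close>); Riemann sums turn them into
  combinations of functions \<open>1 / (s - w)\<close> with \<open>w \<notin> K\<close>; and the pole \<open>w\<close> can be moved through its
  component of the complement of \<open>K\<close>, to a prescribed point if the component is bounded and to infinity
  otherwise (\<open>polynomials_with_pole_component\<close>, \<open>polynomials_with_pole_unbounded\<close>).

  For a compact \<open>L\<close> in \<open>\<Omega>\<close> this is applied to a member \<open>K m\<close> of the exhausting family that contains \<open>L\<close>,
  with poles in \<open>A m\<close>.
\<close>

section \<open>Dirichlet polynomials\<close>

lemma one_over_nat_powr:
  fixes s :: complex
  assumes "n \<ge> 1"
  shows "1 / of_nat n powr s = exp (- (of_real (ln (real n)) * s))"
proof -
  have "Ln (of_nat n) = complex_of_real (ln (real n))"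
    using assms by (metis Ln_of_real of_nat_0_less_iff of_real_of_nat_eq order_less_le_trans zero_less_one)
  then have "of_nat n powr s = exp (s * of_real (ln (real n)))"
    using assms by (simp add: powr_def)
  then show ?thesis
    by (simp add: exp_minus divide_inverse mult.commute)
qed

lemma dirichlet_polynomial_term:
  assumes "n \<ge> 1"
  shows "dirichlet_polynomial (\<lambda>s. c * exp (- (of_real (ln (real n)) * s)))"
proof -
  have "c * exp (- (of_real (ln (real n)) * s)) =
        (\<Sum>k=1..n. (if k = n then c else 0) * (1 / of_nat k powr s))" for s
    using assms by (subst one_over_nat_powr[OF assms, symmetric])
      (simp add: if_distrib[of "\<lambda>x. x / _"] cong: if_cong)
  then show ?thesis
    unfolding dirichlet_polynomial_def
    by (intro exI[of _ n] exI[of _ "\<lambda>k. if k = n then c else 0"]) auto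
qed

lemma dirichlet_polynomial_const: "dirichlet_polynomial (\<lambda>s. c)"
  using dirichlet_polynomial_term[of 1 c] by simp

lemma dirichlet_polynomial_add:
  assumes "dirichlet_polynomial P" "dirichlet_polynomial Q"
  shows "dirichlet_polynomial (\<lambda>s. P s + Q s)"
proof -
  obtain M a where P: "P = (\<lambda>s. \<Sum>n=1..M. a n * (1 / of_nat n powr s))"
    using assms(1) unfolding dirichlet_polynomial_def by blast
  obtain N b where Q: "Q = (\<lambda>s. \<Sum>n=1..N. b n * (1 / of_nat n powr s))"
    using assms(2) unfolding dirichlet_polynomial_def by blast
  have pad: "(\<Sum>n=1..M. a n * (1 / of_nat n powr s)) =
      (\<Sum>n=1..L. (if n \<le> M then a n else 0) * (1 / of_nat n powr s))"
    if "M \<le> L" for M L :: nat and a :: "nat \<Rightarrow> complex" and s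
    using that by (intro sum.mono_neutral_cong_left) auto
  have "P s + Q s = (\<Sum>n=1..max M N. ((if n \<le> M then a n else 0) + (if n \<le> N then b n else 0)) *
      (1 / of_nat n powr s))" for s
    unfolding P Q using pad[of M "max M N" a s] pad[of N "max M N" b s]
    by (simp add: sum.distrib ring_distribs add_divide_distrib)
  then show ?thesis
    unfolding dirichlet_polynomial_def
    by (intro exI[of _ "max M N"] exI[of _ "\<lambda>n. (if n \<le> M then a n else 0) + (if n \<le> N then b n else 0)"]) auto
qed

lemma dirichlet_polynomial_sum:
  assumes "\<And>i. i \<in> I \<Longrightarrow> dirichlet_polynomial (P i)"
  shows "dirichlet_polynomial (\<lambda>s. \<Sum>i\<in>I. P i s)"
  using assms
  by (induction I rule: infinite_finite_induct)
     (auto intro: dirichlet_polynomial_const dirichlet_polynomial_add)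

text \<open>
  This closure under products is what reduces the approximation of all polynomials to the
  approximation of the identity: the exponents \<open>- ln n\<close> form an additive semigroup because
  \<open>m powr (- s) * n powr (- s) = (m * n) powr (- s)\<close>.
\<close>
lemma dirichlet_polynomial_mult:
  assumes "dirichlet_polynomial P" "dirichlet_polynomial Q"
  shows "dirichlet_polynomial (\<lambda>s. P s * Q s)"
proof -
  obtain M a where P: "P = (\<lambda>s. \<Sum>n=1..M. a n * (1 / of_nat n powr s))"
    using assms(1) unfolding dirichlet_polynomial_def by blast
  obtain N b where Q: "Q = (\<lambda>s. \<Sum>n=1..N. b n * (1 / of_nat n powr s))"
    using assms(2) unfolding dirichlet_polynomial_def by blast
  have "P s * Q s = (\<Sum>m=1..M. \<Sum>n=1..N. a m * b n * exp (- (of_real (ln (real (m * n))) * s)))" for s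
    unfolding P Q sum_product
    by (intro sum.cong refl)
       (simp add: one_over_nat_powr ln_mult ring_distribs mult_exp_exp)
  moreover have "dirichlet_polynomial (\<lambda>s. \<Sum>m=1..M. \<Sum>n=1..N. a m * b n * exp (- (of_real (ln (real (m * n))) * s)))"
    by (intro dirichlet_polynomial_sum dirichlet_polynomial_term) (auto simp: Suc_le_eq)
  ultimately show ?thesis by presburger
qed

lemma holomorphic_on_dirichlet_polynomial:
  assumes "dirichlet_polynomial P"
  shows "P holomorphic_on S"
proof -
  obtain M a where P: "P = (\<lambda>s. \<Sum>n=1..M. a n * (1 / of_nat n powr s))"
    using assms unfolding dirichlet_polynomial_def by blast
  have "(\<lambda>s. \<Sum>n=1..M. a n * exp (- (of_real (ln (real n)) * s))) holomorphic_on S"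
    by (intro holomorphic_intros)
  moreover have "P = (\<lambda>s. \<Sum>n=1..M. a n * exp (- (of_real (ln (real n)) * s)))"
    unfolding P by (intro ext sum.cong refl) (simp add: one_over_nat_powr)
  ultimately show ?thesis by simp
qed

section \<open>The identity as a limit of Dirichlet polynomials\<close>

text \<open>
  The double zero at the origin is the point: after multiplication by \<open>exp (- (w * s))\<close> and
  integration, the term \<open>1 / w\<^sup>2\<close> contributes the derivative at \<open>0\<close>, which is \<open>- s\<close>, while every other
  term contributes a constant or an exponential. Only the coefficient of \<open>1 / w\<^sup>2\<close> has to be known.
\<close>
lemma partial_fractions_double_zero:
  fixes S :: "'a::field set"
  assumes "finite S" "0 \<notin> S"
  shows "\<exists>\<beta> \<gamma>. \<forall>w. w \<noteq> 0 \<and> w \<notin> S \<longrightarrow>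
    1 / (w\<^sup>2 * (\<Prod>a\<in>S. w - a)) = 1 / (\<Prod>a\<in>S. - a) / w\<^sup>2 + \<beta> / w + (\<Sum>a\<in>S. \<gamma> a / (w - a))"
  using assms
proof (induction S rule: finite_induct)
  case empty
  then show ?case by (auto intro!: exI[of _ 0])
next
  case (insert b S)
  then obtain \<beta> \<gamma> where *: "\<And>w. w \<noteq> 0 \<Longrightarrow> w \<notin> S \<Longrightarrow>
    1 / (w\<^sup>2 * (\<Prod>a\<in>S. w - a)) = 1 / (\<Prod>a\<in>S. - a) / w\<^sup>2 + \<beta> / w + (\<Sum>a\<in>S. \<gamma> a / (w - a))"
    by auto
  define \<alpha> where "\<alpha> = 1 / (\<Prod>a\<in>S. - a)"
  have b: "b \<noteq> 0" using insert.prems by auto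
  \<comment> \<open>The new node is split off from each old term separately; \<open>\<gamma>'\<close> at \<open>b\<close> collects what all
  of them leave at \<open>b\<close>, and is the value at \<open>b\<close> of the old partial fraction sum.\<close>
  define \<beta>' where "\<beta>' = - \<alpha> / b\<^sup>2 - \<beta> / b"
  define \<gamma>' where "\<gamma>' = (\<lambda>a. if a = b then \<alpha> / b\<^sup>2 + \<beta> / b + (\<Sum>a\<in>S. \<gamma> a / (b - a)) else - \<gamma> a / (b - a))"
  have "1 / (w\<^sup>2 * (\<Prod>a\<in>insert b S. w - a)) =
     1 / (\<Prod>a\<in>insert b S. - a) / w\<^sup>2 + \<beta>' / w + (\<Sum>a\<in>insert b S. \<gamma>' a / (w - a))"
    if w: "w \<noteq> 0" "w \<notin> insert b S" for w
  proof -
    have wb: "w - b \<noteq> 0" using w by auto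
    have "1 / (w\<^sup>2 * (\<Prod>a\<in>insert b S. w - a)) = 1 / (w\<^sup>2 * (\<Prod>a\<in>S. w - a)) / (w - b)"
      using insert.hyps by simp
    also have "\<dots> = (\<alpha> / w\<^sup>2 + \<beta> / w + (\<Sum>a\<in>S. \<gamma> a / (w - a))) / (w - b)"
      using * w by (simp add: \<alpha>_def)
    also have "\<dots> = \<alpha> / w\<^sup>2 / (w - b) + \<beta> / w / (w - b) + (\<Sum>a\<in>S. \<gamma> a / (w - a) / (w - b))"
      by (simp add: add_divide_distrib sum_divide_distrib)
    also have "\<alpha> / w\<^sup>2 / (w - b) = (- \<alpha> / b) / w\<^sup>2 - (\<alpha> / b\<^sup>2) / w + (\<alpha> / b\<^sup>2) / (w - b)"
      using b wb w by (simp add: divide_simps power2_eq_square) (simp add: algebra_simps)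
    also have "\<beta> / w / (w - b) = (\<beta> / b) / (w - b) - (\<beta> / b) / w"
      using b wb w by (simp add: divide_simps) (simp add: algebra_simps)
    also have "(\<Sum>a\<in>S. \<gamma> a / (w - a) / (w - b)) = (\<Sum>a\<in>S. \<gamma> a / (b - a) / (w - b) + \<gamma>' a / (w - a))"
    proof (intro sum.cong refl)
      fix a assume a: "a \<in> S"
      then have "b - a \<noteq> 0" "w - a \<noteq> 0" "a \<noteq> b" using insert.hyps w by auto
      then show "\<gamma> a / (w - a) / (w - b) = \<gamma> a / (b - a) / (w - b) + \<gamma>' a / (w - a)"
        using wb by (simp add: \<gamma>'_def divide_simps) (simp add: algebra_simps)
    qed
    also have "\<dots> = (\<Sum>a\<in>S. \<gamma> a / (b - a)) / (w - b) + (\<Sum>a\<in>S. \<gamma>' a / (w - a))"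
      by (simp add: sum.distrib sum_divide_distrib)
    finally have "1 / (w\<^sup>2 * (\<Prod>a\<in>insert b S. w - a)) =
        - \<alpha> / b / w\<^sup>2 - \<alpha> / b\<^sup>2 / w + \<alpha> / b\<^sup>2 / (w - b) + (\<beta> / b / (w - b) - \<beta> / b / w) +
        ((\<Sum>a\<in>S. \<gamma> a / (b - a)) / (w - b) + (\<Sum>a\<in>S. \<gamma>' a / (w - a)))" .
    also have "\<dots> = - \<alpha> / b / w\<^sup>2 + \<beta>' / w + (\<gamma>' b / (w - b) + (\<Sum>a\<in>S. \<gamma>' a / (w - a)))"
      by (simp add: \<beta>'_def \<gamma>'_def add_divide_distrib diff_divide_distrib)
    also have "- \<alpha> / b = 1 / (\<Prod>a\<in>insert b S. - a)"
      using insert.hyps by (simp add: \<alpha>_def divide_inverse)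
    finally show ?thesis using insert.hyps by simp
  qed
  then show ?case by blast
qed

text \<open>
  The constants \<open>\<beta>\<close> and \<open>\<gamma>\<close> do not depend on \<open>s\<close>. So the integral is, as a function of \<open>s\<close>, a
  constant plus an exponential sum with frequencies in \<open>S\<close> minus an explicit nonzero multiple of \<open>s\<close>.
\<close>
lemma contour_integral_exp_over_nodes:
  fixes S :: "complex set"
  assumes S: "finite S" "0 \<notin> S" "S \<subseteq> ball 0 \<rho>" and \<rho>: "\<rho> > 0"
  shows "\<exists>\<beta> \<gamma>. \<forall>s. ((\<lambda>w. exp (- (w * s)) / (w\<^sup>2 * (\<Prod>a\<in>S. w - a))) has_contour_integral
      2 * of_real pi * \<i> * (\<beta> + (\<Sum>a\<in>S. \<gamma> a * exp (- (a * s))) - s / (\<Prod>a\<in>S. - a))) (circlepath 0 \<rho>)"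
proof -
  obtain \<beta> \<gamma> where pf: "\<And>w. w \<noteq> 0 \<Longrightarrow> w \<notin> S \<Longrightarrow> 1 / (w\<^sup>2 * (\<Prod>a\<in>S. w - a)) =
      1 / (\<Prod>a\<in>S. - a) / w\<^sup>2 + \<beta> / w + (\<Sum>a\<in>S. \<gamma> a / (w - a))"
    using partial_fractions_double_zero[OF S(1,2)] by blast
  define \<alpha> where "\<alpha> = 1 / (\<Prod>a\<in>S. - a)"
  have "((\<lambda>w. exp (- (w * s)) / (w\<^sup>2 * (\<Prod>a\<in>S. w - a))) has_contour_integral
      2 * of_real pi * \<i> * (\<beta> + (\<Sum>a\<in>S. \<gamma> a * exp (- (a * s))) - s / (\<Prod>a\<in>S. - a))) (circlepath 0 \<rho>)" for s
  proof -
    let ?e = "\<lambda>w. exp (- (w * s))"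
    have hol: "?e holomorphic_on T" for T by (intro holomorphic_intros)
    have cont: "continuous_on T ?e" for T by (intro continuous_intros)
    have simple: "((\<lambda>w. ?e w / (w - a)) has_contour_integral (2 * of_real pi * \<i> * ?e a)) (circlepath 0 \<rho>)"
      if "a \<in> ball 0 \<rho>" for a
      using Cauchy_has_contour_integral_higher_derivative_circlepath[OF cont hol that, of 0] by simp
    have "deriv ?e 0 = - s"
      by (rule DERIV_imp_deriv) (auto intro!: derivative_eq_intros)
    then have double: "((\<lambda>w. ?e w / w\<^sup>2) has_contour_integral (2 * of_real pi * \<i> * (- s))) (circlepath 0 \<rho>)"
      using Cauchy_has_contour_integral_higher_derivative_circlepath[OF cont hol, of 0 0 \<rho> 1] \<rho>
      by (simp add: power2_eq_square)
    have "((\<lambda>w. \<alpha> * (?e w / w\<^sup>2) + \<beta> * (?e w / (w - 0)) + (\<Sum>a\<in>S. \<gamma> a * (?e w / (w - a))))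
       has_contour_integral (\<alpha> * (2 * of_real pi * \<i> * (- s)) + \<beta> * (2 * of_real pi * \<i> * ?e 0) +
         (\<Sum>a\<in>S. \<gamma> a * (2 * of_real pi * \<i> * ?e a)))) (circlepath 0 \<rho>)"
      using S \<rho> by (intro has_contour_integral_add has_contour_integral_sum has_contour_integral_lmul double simple) auto
    also have "\<alpha> * (2 * of_real pi * \<i> * (- s)) + \<beta> * (2 * of_real pi * \<i> * ?e 0) +
         (\<Sum>a\<in>S. \<gamma> a * (2 * of_real pi * \<i> * ?e a)) =
       2 * of_real pi * \<i> * (\<beta> + (\<Sum>a\<in>S. \<gamma> a * exp (- (a * s))) - s / (\<Prod>a\<in>S. - a))"
      by (simp add: \<alpha>_def algebra_simps sum_distrib_left)
    finally show ?thesis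
    proof (rule has_contour_integral_eq)
      fix w assume "w \<in> path_image (circlepath 0 \<rho>)"
      with \<rho> have "norm w = \<rho>" by simp
      with S \<rho> have w: "w \<noteq> 0" "w \<notin> S" by auto
      have "exp (- (w * s)) / (w\<^sup>2 * (\<Prod>a\<in>S. w - a)) = ?e w * (1 / (w\<^sup>2 * (\<Prod>a\<in>S. w - a)))"
        by simp
      also have "\<dots> = ?e w * (\<alpha> / w\<^sup>2 + \<beta> / w + (\<Sum>a\<in>S. \<gamma> a / (w - a)))"
        by (subst pf[OF w]) (simp add: \<alpha>_def)
      also have "\<dots> = \<alpha> * (?e w / w\<^sup>2) + \<beta> * (?e w / (w - 0)) + (\<Sum>a\<in>S. \<gamma> a * (?e w / (w - a)))"
        by (simp add: algebra_simps sum_distrib_left)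
      finally show "\<alpha> * (?e w / w\<^sup>2) + \<beta> * (?e w / (w - 0)) + (\<Sum>a\<in>S. \<gamma> a * (?e w / (w - a))) =
        exp (- (w * s)) / (w\<^sup>2 * (\<Prod>a\<in>S. w - a))" by simp
    qed
  qed
  then show ?thesis by blast
qed

text \<open>
  With nodes \<open>ln 2, \<dots>, ln N\<close> the contour integral of the previous lemma is, up to a factor, \<open>s\<close> minus a
  Dirichlet polynomial. On the circle of radius \<open>4 * ln N\<close> every factor \<open>w - a\<close> has modulus at least
  \<open>3 * ln N\<close>, whereas the factors \<open>a\<close> that come from normalising the coefficient of \<open>s\<close> have modulus at
  most \<open>ln N\<close>. This gains \<open>3 ^ (N - 1)\<close>, and \<open>exp (- (w * s))\<close> costs only \<open>N powr (4 * r)\<close>: the logarithms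
  are so dense on the half-line that the number of nodes is exponential in the radius.
\<close>
lemma identity_approx_dirichlet_explicit:
  fixes r :: real
  assumes N: "N \<ge> 3"
  shows "\<exists>P. dirichlet_polynomial P \<and>
    (\<forall>s. norm s \<le> r \<longrightarrow> norm (P s - s) \<le> real N powr (4 * r) / 3 ^ (N - 1))"
proof -
  define l where "l = ln (real N)"
  define S where "S = (\<lambda>n. complex_of_real (ln (real n))) ` {2..N}"
  \<comment> \<open>\<open>N \<ge> 3\<close> gives \<open>ln N \<ge> 1\<close>, so the factor \<open>1 / (4 * l)\<close> in the estimate below may be dropped.\<close>
  have l1: "l \<ge> 1"
    using N exp_le unfolding l_def by (subst ln_ge_iff) auto
  have inj: "inj_on (\<lambda>n. complex_of_real (ln (real n))) {2..N}"
    by (auto simp: inj_on_def)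
  have Sn: "norm a \<le> l" "a \<noteq> 0" if "a \<in> S" for a
    using that unfolding S_def l_def by auto
  have finS: "finite S" and cardS: "card S = N - 1"
    unfolding S_def using inj by (auto simp: card_image)
  have "S \<subseteq> ball 0 (4 * l)" using Sn(1) l1 by force
  then obtain \<beta> \<gamma> where int: "\<And>s. ((\<lambda>w. exp (- (w * s)) / (w\<^sup>2 * (\<Prod>a\<in>S. w - a))) has_contour_integral
      2 * of_real pi * \<i> * (\<beta> + (\<Sum>a\<in>S. \<gamma> a * exp (- (a * s))) - s / (\<Prod>a\<in>S. - a))) (circlepath 0 (4 * l))"
    using contour_integral_exp_over_nodes[of S "4 * l"] finS Sn l1 by force
  define \<pi> where "\<pi> = (\<Prod>a\<in>S. - a)"
  have \<pi>0: "\<pi> \<noteq> 0" unfolding \<pi>_def using finS Sn by auto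
  have n\<pi>: "norm \<pi> \<le> l ^ (N - 1)"
  proof -
    have "norm \<pi> = (\<Prod>a\<in>S. norm a)" by (simp add: \<pi>_def prod_norm[symmetric])
    also have "\<dots> \<le> (\<Prod>a\<in>S. l)" by (intro prod_mono) (use Sn in auto)
    finally show ?thesis by (simp add: cardS)
  qed
  define P where "P = (\<lambda>s. \<pi> * \<beta> + (\<Sum>a\<in>S. \<pi> * \<gamma> a * exp (- (a * s))))"
  have "dirichlet_polynomial P"
    unfolding P_def S_def sum.reindex[OF inj] o_def
    by (rule dirichlet_polynomial_add[OF dirichlet_polynomial_const dirichlet_polynomial_sum[OF dirichlet_polynomial_term]])
       auto
  moreover have "norm (P s - s) \<le> real N powr (4 * r) / 3 ^ (N - 1)" if s: "norm s \<le> r" for s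
  proof -
    define J where "J = \<beta> + (\<Sum>a\<in>S. \<gamma> a * exp (- (a * s))) - s / \<pi>"
    have "norm (2 * of_real pi * \<i> * J) \<le> exp (4 * l * r) / ((4 * l)\<^sup>2 * (3 * l) ^ (N - 1)) * (2 * pi * (4 * l))"
    proof (rule has_contour_integral_bound_circlepath)
      show "((\<lambda>w. exp (- (w * s)) / (w\<^sup>2 * (\<Prod>a\<in>S. w - a))) has_contour_integral
          2 * of_real pi * \<i> * J) (circlepath 0 (4 * l))"
        using int[of s] by (simp add: J_def \<pi>_def)
      fix w :: complex assume "norm (w - 0) = 4 * l"
      then have w: "norm w = 4 * l" by simp
      have "norm (exp (- (w * s))) \<le> exp (norm (- (w * s)))" by (rule norm_exp)
      also have "\<dots> \<le> exp (4 * l * r)"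
        using s l1 w by (simp add: norm_mult mult_left_mono)
      finally have e: "norm (exp (- (w * s))) \<le> exp (4 * l * r)" .
      have "(3 * l) ^ (N - 1) = (\<Prod>a\<in>S. 3 * l)" by (simp add: cardS)
      also have "\<dots> \<le> (\<Prod>a\<in>S. norm (w - a))"
      proof (intro prod_mono conjI)
        fix a assume "a \<in> S"
        then show "3 * l \<le> norm (w - a)"
          using norm_triangle_ineq2[of w a] w Sn(1)[of a] by simp
      qed (use l1 in simp)
      finally have p: "(3 * l) ^ (N - 1) \<le> norm (\<Prod>a\<in>S. w - a)" by (simp add: prod_norm)
      show "norm (exp (- (w * s)) / (w\<^sup>2 * (\<Prod>a\<in>S. w - a))) \<le> exp (4 * l * r) / ((4 * l)\<^sup>2 * (3 * l) ^ (N - 1))"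
        unfolding norm_divide norm_mult norm_power w
        using l1 by (intro frac_le mult_left_mono e p mult_pos_pos) auto
    qed (use l1 in auto)
    then have "norm J \<le> exp (4 * l * r) / ((4 * l) * (3 * l) ^ (N - 1))"
      using l1 by (simp add: norm_mult divide_simps power2_eq_square power_mult_distrib mult_ac split: if_splits)
    also have "\<dots> \<le> exp (4 * l * r) / (1 * (3 * l) ^ (N - 1))"
      using l1 by (intro divide_left_mono mult_right_mono) auto
    finally have J: "norm J \<le> exp (4 * l * r) / (3 * l) ^ (N - 1)" by simp
    have "P s - s = \<pi> * J"
      using \<pi>0 by (simp add: P_def J_def algebra_simps sum_distrib_left)
    then have "norm (P s - s) = norm \<pi> * norm J" by (simp add: norm_mult)
    also have "\<dots> \<le> l ^ (N - 1) * (exp (4 * l * r) / (3 * l) ^ (N - 1))"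
      by (intro mult_mono n\<pi> J) (use l1 in auto)
    also have "\<dots> = exp (4 * l * r) / 3 ^ (N - 1)"
      using l1 by (simp add: power_mult_distrib)
    also have "exp (4 * l * r) = real N powr (4 * r)"
      using N by (simp add: powr_def l_def mult_ac)
    finally show ?thesis .
  qed
  ultimately show ?thesis by blast
qed

lemma identity_approx_dirichlet:
  fixes r \<epsilon> :: real
  assumes "\<epsilon> > 0"
  shows "\<exists>P. dirichlet_polynomial P \<and> (\<forall>s. norm s \<le> r \<longrightarrow> dist (P s) s < \<epsilon>)"
proof -
  have "((\<lambda>N::nat. real N powr (4 * r) / 3 ^ (N - 1)) \<longlongrightarrow> 0) at_top"
    by real_asymp
  then have "eventually (\<lambda>N::nat. real N powr (4 * r) / 3 ^ (N - 1) < \<epsilon>) at_top"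
    using assms by (rule order_tendstoD)
  then have "eventually (\<lambda>N::nat. N \<ge> 3 \<and> real N powr (4 * r) / 3 ^ (N - 1) < \<epsilon>) at_top"
    by (intro eventually_conj eventually_ge_at_top)
  then obtain N :: nat where N: "N \<ge> 3" "real N powr (4 * r) / 3 ^ (N - 1) < \<epsilon>"
    by (auto simp: eventually_at_top_linorder)
  obtain P where "dirichlet_polynomial P"
    "\<And>s. norm s \<le> r \<Longrightarrow> norm (P s - s) \<le> real N powr (4 * r) / 3 ^ (N - 1)"
    using identity_approx_dirichlet_explicit[OF N(1)] by blast
  then show ?thesis
    unfolding dist_norm using N(2) le_less_trans by blast
qed

section \<open>Uniform closures\<close>

definition uniform_closure :: "'a set \<Rightarrow> ('a \<Rightarrow> 'b::metric_space) set \<Rightarrow> ('a \<Rightarrow> 'b) set" where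
  "uniform_closure K F = {g. \<forall>\<epsilon>>0. \<exists>h\<in>F. \<forall>s\<in>K. dist (h s) (g s) < \<epsilon>}"

lemma uniform_closureI:
  "(\<And>\<epsilon>. \<epsilon> > 0 \<Longrightarrow> \<exists>h\<in>F. \<forall>s\<in>K. dist (h s) (g s) < \<epsilon>) \<Longrightarrow> g \<in> uniform_closure K F"
  by (simp add: uniform_closure_def)

lemma uniform_closureD:
  assumes "g \<in> uniform_closure K F" "\<epsilon> > 0"
  obtains h where "h \<in> F" "\<And>s. s \<in> K \<Longrightarrow> dist (h s) (g s) < \<epsilon>"
  using assms unfolding uniform_closure_def by blast

lemma uniform_closure_cong:
  assumes "g \<in> uniform_closure K F" "\<And>s. s \<in> K \<Longrightarrow> g s = g' s"
  shows "g' \<in> uniform_closure K F"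
  using assms unfolding uniform_closure_def by simp

lemma subset_uniform_closure: "F \<subseteq> uniform_closure K F"
  by (auto intro!: uniform_closureI bexI)

text \<open>
  Iterated approximation is approximation; every chain of approximations below is composed with this fact
  and its consequence for subsets.
\<close>
lemma uniform_closure_closed:
  assumes "\<And>\<epsilon>. \<epsilon> > 0 \<Longrightarrow> \<exists>h\<in>uniform_closure K F. \<forall>s\<in>K. dist (h s) (g s) < \<epsilon>"
  shows "g \<in> uniform_closure K F"
proof (rule uniform_closureI)
  fix \<epsilon> :: real assume "\<epsilon> > 0"
  then obtain h where h: "h \<in> uniform_closure K F" "\<And>s. s \<in> K \<Longrightarrow> dist (h s) (g s) < \<epsilon> / 2"
    using assms[of "\<epsilon> / 2"] by auto
  obtain p where p: "p \<in> F" "\<And>s. s \<in> K \<Longrightarrow> dist (p s) (h s) < \<epsilon> / 2"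
    using uniform_closureD[OF h(1), of "\<epsilon> / 2"] \<open>\<epsilon> > 0\<close> by auto
  show "\<exists>p\<in>F. \<forall>s\<in>K. dist (p s) (g s) < \<epsilon>"
    using p h(2) dist_triangle_half_r by (metis dist_commute)
qed

lemma uniform_closure_minimal:
  assumes "F \<subseteq> uniform_closure K F'"
  shows "uniform_closure K F \<subseteq> uniform_closure K F'"
  using assms by (intro subsetI uniform_closure_closed) (meson subsetD uniform_closureD)

lemma uniform_closure_add:
  fixes g g' :: "'a \<Rightarrow> 'b::real_normed_vector"
  assumes "\<And>f f'. f \<in> F \<Longrightarrow> f' \<in> F \<Longrightarrow> (\<lambda>s. f s + f' s) \<in> F"
    and g: "g \<in> uniform_closure K F" and g': "g' \<in> uniform_closure K F"
  shows "(\<lambda>s. g s + g' s) \<in> uniform_closure K F"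
proof (rule uniform_closureI)
  fix \<epsilon> :: real assume "\<epsilon> > 0"
  then have "\<epsilon> / 2 > 0" by simp
  obtain h where h: "h \<in> F" "\<And>s. s \<in> K \<Longrightarrow> dist (h s) (g s) < \<epsilon> / 2"
    using uniform_closureD[OF g \<open>\<epsilon> / 2 > 0\<close>] by blast
  obtain h' where h': "h' \<in> F" "\<And>s. s \<in> K \<Longrightarrow> dist (h' s) (g' s) < \<epsilon> / 2"
    using uniform_closureD[OF g' \<open>\<epsilon> / 2 > 0\<close>] by blast
  have "dist (h s + h' s) (g s + g' s) < \<epsilon>" if "s \<in> K" for s
    using h(2)[OF that] h'(2)[OF that] by (intro dist_triangle_add_half)
  then show "\<exists>p\<in>F. \<forall>s\<in>K. dist (p s) (g s + g' s) < \<epsilon>"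
    using assms(1)[OF h(1) h'(1)] by (intro bexI) auto
qed

lemma uniform_closure_mult:
  fixes g g' :: "'a \<Rightarrow> 'b::real_normed_algebra"
  assumes mult: "\<And>f f'. f \<in> F \<Longrightarrow> f' \<in> F \<Longrightarrow> (\<lambda>s. f s * f' s) \<in> F"
    and g: "g \<in> uniform_closure K F" "bounded (g ` K)" and g': "g' \<in> uniform_closure K F" "bounded (g' ` K)"
  shows "(\<lambda>s. g s * g' s) \<in> uniform_closure K F"
proof (rule uniform_closureI)
  fix \<epsilon> :: real assume \<epsilon>: "\<epsilon> > 0"
  obtain B where B: "B > 0" "\<And>s. s \<in> K \<Longrightarrow> norm (g s) \<le> B"
    using g(2) by (auto simp: bounded_pos)
  obtain B' where B': "B' > 0" "\<And>s. s \<in> K \<Longrightarrow> norm (g' s) \<le> B'"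
    using g'(2) by (auto simp: bounded_pos)
  define d where "d = min 1 (\<epsilon> / (B + B' + 1))"
  have "B + B' + 1 > 0" using B(1) B'(1) by simp
  then have d: "d > 0" "d \<le> 1" "d * (B + B' + 1) \<le> \<epsilon>"
    using \<epsilon> unfolding pos_le_divide_eq[OF \<open>B + B' + 1 > 0\<close>, symmetric] by (simp_all add: d_def)
  obtain h where h: "h \<in> F" "\<And>s. s \<in> K \<Longrightarrow> dist (h s) (g s) < d"
    using uniform_closureD[OF g(1) d(1)] by blast
  obtain h' where h': "h' \<in> F" "\<And>s. s \<in> K \<Longrightarrow> dist (h' s) (g' s) < d"
    using uniform_closureD[OF g'(1) d(1)] by blast
  have "dist (h s * h' s) (g s * g' s) < \<epsilon>" if s: "s \<in> K" for s
  proof -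
    have a: "norm (h s - g s) < d" "norm (h' s - g' s) < d"
      using h(2)[OF s] h'(2)[OF s] by (auto simp: dist_norm)
    then have "norm (h' s) \<le> B' + 1"
      using B'(2)[OF s] d(2) norm_triangle_ineq[of "h' s - g' s" "g' s"] by simp
    have "h s * h' s - g s * g' s = (h s - g s) * h' s + g s * (h' s - g' s)"
      by (simp add: algebra_simps)
    then have "dist (h s * h' s) (g s * g' s) \<le> norm ((h s - g s) * h' s) + norm (g s * (h' s - g' s))"
      unfolding dist_norm by (metis norm_triangle_ineq)
    also have "\<dots> \<le> norm (h s - g s) * norm (h' s) + norm (g s) * norm (h' s - g' s)"
      by (intro add_mono norm_mult_ineq)
    also have "\<dots> \<le> norm (h s - g s) * (B' + 1) + B * norm (h' s - g' s)"
      using B(2)[OF s] \<open>norm (h' s) \<le> B' + 1\<close> by (intro add_mono mult_mono) (use B B' in auto)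
    also have "\<dots> < d * (B' + 1) + B * d"
      using a B(1) B'(1) by (intro add_strict_mono mult_strict_right_mono mult_strict_left_mono) auto
    also have "\<dots> \<le> \<epsilon>" using d(3) by (simp add: algebra_simps)
    finally show ?thesis .
  qed
  then show "\<exists>p\<in>F. \<forall>s\<in>K. dist (p s) (g s * g' s) < \<epsilon>"
    using mult[OF h(1) h'(1)] by (intro bexI) auto
qed

section \<open>From polynomials to Dirichlet polynomials\<close>

definition polynomials_in :: "('a \<Rightarrow> complex) \<Rightarrow> ('a \<Rightarrow> complex) set" where
  "polynomials_in \<phi> = range (\<lambda>p s. poly p (\<phi> s))"

text \<open>
  Horner's scheme builds a polynomial from constants and the identity by sums and products, and the uniform
  closure of the Dirichlet polynomials on a disc is closed under both.
\<close>
lemma poly_in_uniform_closure_dirichlet: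
  "poly p \<in> uniform_closure (cball 0 r) (Collect dirichlet_polynomial)"
proof (induction p)
  case 0
  then show ?case
    using subset_uniform_closure[of "Collect dirichlet_polynomial"] dirichlet_polynomial_const[of 0] by auto
next
  case (pCons a p)
  let ?D = "Collect dirichlet_polynomial" and ?U = "uniform_closure (cball 0 r) (Collect dirichlet_polynomial)"
  have bdd: "bounded (f ` cball 0 r)" if "continuous_on (cball 0 r) f" for f :: "complex \<Rightarrow> complex"
    using that by (intro compact_imp_bounded compact_continuous_image compact_cball)
  have "(\<lambda>s. s) \<in> ?U"
  proof (rule uniform_closureI)
    fix \<epsilon> :: real assume "\<epsilon> > 0"
    then show "\<exists>h\<in>?D. \<forall>s\<in>cball 0 r. dist (h s) s < \<epsilon>"
      using identity_approx_dirichlet[of \<epsilon> r] by auto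
  qed
  then have "(\<lambda>s. s * poly p s) \<in> ?U"
    using pCons.IH by (intro uniform_closure_mult bdd continuous_intros) (auto intro: dirichlet_polynomial_mult)
  moreover have "(\<lambda>s. a) \<in> ?U"
    using subset_uniform_closure[of ?D] dirichlet_polynomial_const[of a] by auto
  ultimately have "(\<lambda>s. a + s * poly p s) \<in> ?U"
    by (intro uniform_closure_add) (auto intro: dirichlet_polynomial_add)
  then show ?case by (rule uniform_closure_cong) simp
qed

lemma polynomials_in_subset_dirichlet:
  assumes "bounded (\<phi> ` K)"
  shows "uniform_closure K (polynomials_in \<phi>) \<subseteq> uniform_closure K {\<lambda>s. P (\<phi> s) |P. dirichlet_polynomial P}"
proof (rule uniform_closure_minimal, rule subsetI, rule uniform_closureI)
  fix g and \<epsilon> :: real assume "g \<in> polynomials_in \<phi>" and \<epsilon>: "\<epsilon> > 0"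
  then obtain p where g: "g = (\<lambda>s. poly p (\<phi> s))" by (auto simp: polynomials_in_def)
  obtain r where r: "\<And>s. s \<in> K \<Longrightarrow> norm (\<phi> s) \<le> r"
    using assms by (auto simp: bounded_iff)
  obtain P where "dirichlet_polynomial P" "\<And>z. z \<in> cball 0 r \<Longrightarrow> dist (P z) (poly p z) < \<epsilon>"
    using uniform_closureD[OF poly_in_uniform_closure_dirichlet \<epsilon>] by (metis mem_Collect_eq)
  then show "\<exists>h\<in>{\<lambda>s. P (\<phi> s) |P. dirichlet_polynomial P}. \<forall>s\<in>K. dist (h s) (g s) < \<epsilon>"
    using r unfolding g by auto
qed

section \<open>Moving poles\<close>

text \<open>
  If \<open>\<psi>\<close> is approximated by \<open>q \<circ> \<phi>\<close> then \<open>p \<circ> \<psi>\<close> is approximated by \<open>(p \<circ> q) \<circ> \<phi>\<close>, since \<open>p\<close> is uniformly continuous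
  on bounded sets. Hence it suffices to approximate the single function \<open>\<psi>\<close> in order to move a whole
  polynomial algebra.
\<close>
lemma uniform_closure_polynomials_trans:
  assumes \<psi>: "\<psi> \<in> uniform_closure K (polynomials_in \<phi>)" and bdd: "bounded (\<psi> ` K)"
  shows "uniform_closure K (polynomials_in \<psi>) \<subseteq> uniform_closure K (polynomials_in \<phi>)"
proof (rule uniform_closure_minimal, rule subsetI, rule uniform_closureI)
  fix g and \<epsilon> :: real assume "g \<in> polynomials_in \<psi>" and \<epsilon>: "\<epsilon> > 0"
  then obtain p where g: "g = (\<lambda>s. poly p (\<psi> s))" by (auto simp: polynomials_in_def)
  obtain B where B: "\<And>s. s \<in> K \<Longrightarrow> norm (\<psi> s) \<le> B"
    using bdd by (auto simp: bounded_iff)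
  have "uniformly_continuous_on (cball 0 (B + 1)) (poly p)"
    by (intro compact_uniformly_continuous compact_cball) (intro continuous_intros)
  then obtain d where d: "d > 0" "\<And>x y. x \<in> cball 0 (B + 1) \<Longrightarrow> y \<in> cball 0 (B + 1) \<Longrightarrow> dist y x < d \<Longrightarrow>
      dist (poly p y) (poly p x) < \<epsilon>"
    using \<epsilon> unfolding uniformly_continuous_on_def by meson
  obtain q where q: "\<And>s. s \<in> K \<Longrightarrow> dist (poly q (\<phi> s)) (\<psi> s) < min d 1"
    using uniform_closureD[OF \<psi>, of "min d 1"] d(1) by (auto simp: polynomials_in_def)
  have "dist (poly (pcompose p q) (\<phi> s)) (g s) < \<epsilon>" if s: "s \<in> K" for s
  proof -
    have "norm (poly q (\<phi> s)) \<le> B + 1"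
      using q[OF s] B[OF s] norm_triangle_ineq[of "poly q (\<phi> s) - \<psi> s" "\<psi> s"] by (simp add: dist_norm)
    then show ?thesis
      using q[OF s] B[OF s] unfolding g poly_pcompose by (intro d(2)) simp_all
  qed
  then show "\<exists>h\<in>polynomials_in \<phi>. \<forall>s\<in>K. dist (h s) (g s) < \<epsilon>"
    by (intro bexI[of _ "\<lambda>s. poly (pcompose p q) (\<phi> s)"]) (auto simp: polynomials_in_def)
qed

text \<open>
  The truncated geometric series is the only expansion needed: it re-expands a simple pole around a nearby
  pole and also around infinity. The numerator \<open>q\<close> covers both uses.
\<close>
lemma geometric_in_uniform_closure:
  assumes half: "\<And>s. s \<in> K \<Longrightarrow> norm (c * \<phi> s) \<le> 1 / 2" and bdd: "bounded ((\<lambda>s. poly q (\<phi> s)) ` K)"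
  shows "(\<lambda>s. poly q (\<phi> s) / (1 - c * \<phi> s)) \<in> uniform_closure K (polynomials_in \<phi>)"
proof (rule uniform_closureI)
  fix \<epsilon> :: real assume \<epsilon>: "\<epsilon> > 0"
  obtain B where B: "B > 0" "\<And>s. s \<in> K \<Longrightarrow> norm (poly q (\<phi> s)) \<le> B"
    using bdd by (auto simp: bounded_pos)
  obtain N where N: "(1 / 2) ^ N < \<epsilon> / (2 * B)"
    using real_arch_pow_inv[of "\<epsilon> / (2 * B)" "1 / 2"] \<epsilon> B(1) by auto
  define p where "p = q * (\<Sum>i<N. [:0, c:] ^ i)"
  have "dist (poly p (\<phi> s)) (poly q (\<phi> s) / (1 - c * \<phi> s)) < \<epsilon>" if s: "s \<in> K" for s
  proof -
    let ?x = "c * \<phi> s"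
    have x: "norm ?x \<le> 1 / 2" using half[OF s] .
    then have "?x \<noteq> 1" by force
    have lower: "norm (1 - ?x) \<ge> 1 / 2"
      using norm_triangle_ineq2[of 1 ?x] x by simp
    have "poly p (\<phi> s) = poly q (\<phi> s) * ((1 - ?x ^ N) / (1 - ?x))"
      using \<open>?x \<noteq> 1\<close> by (simp add: p_def poly_sum poly_power sum_gp_strict mult.commute[of c])
    then have "poly p (\<phi> s) - poly q (\<phi> s) / (1 - ?x) = - (poly q (\<phi> s) * ?x ^ N / (1 - ?x))"
      by (simp add: right_diff_distrib diff_divide_distrib)
    then have "dist (poly p (\<phi> s)) (poly q (\<phi> s) / (1 - ?x)) = norm (poly q (\<phi> s)) * norm ?x ^ N / norm (1 - ?x)"
      by (simp only: dist_norm norm_minus_cancel norm_divide norm_mult norm_power)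
    also have "\<dots> \<le> B * (1 / 2) ^ N / (1 / 2)"
      using B x lower s by (intro frac_le mult_mono power_mono) auto
    also have "\<dots> < \<epsilon>" using N B(1) by (simp add: field_simps)
    finally show ?thesis .
  qed
  then show "\<exists>h\<in>polynomials_in \<phi>. \<forall>s\<in>K. dist (h s) (poly q (\<phi> s) / (1 - c * \<phi> s)) < \<epsilon>"
    by (intro bexI[of _ "\<lambda>s. poly p (\<phi> s)"]) (auto simp: polynomials_in_def)
qed

abbreviation polynomials_with_pole :: "complex \<Rightarrow> (complex \<Rightarrow> complex) set" where
  "polynomials_with_pole w \<equiv> polynomials_in (\<lambda>s. 1 / (s - w))"

lemma bounded_reciprocal_image:
  fixes K :: "complex set"
  assumes "compact K" "w \<notin> K"
  shows "bounded ((\<lambda>s. 1 / (s - w)) ` K)"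
  using assms by (intro compact_imp_bounded compact_continuous_image continuous_intros) auto

text \<open>
  With \<open>u = 1 / (s - w)\<close> and \<open>c = w' - w\<close> one has \<open>1 / (s - w') = u / (1 - c * u)\<close>.
\<close>
lemma polynomials_with_pole_near:
  assumes K: "compact K" "w \<notin> K" "w' \<notin> K" and near: "\<And>s. s \<in> K \<Longrightarrow> 2 * dist w w' \<le> dist s w"
  shows "uniform_closure K (polynomials_with_pole w') \<subseteq> uniform_closure K (polynomials_with_pole w)"
proof (rule uniform_closure_polynomials_trans[OF _ bounded_reciprocal_image[OF K(1,3)]])
  have "(\<lambda>s. poly [:0, 1:] (1 / (s - w)) / (1 - (w' - w) * (1 / (s - w)))) \<in> uniform_closure K (polynomials_with_pole w)"
  proof (rule geometric_in_uniform_closure)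
    show "norm ((w' - w) * (1 / (s - w))) \<le> 1 / 2" if "s \<in> K" for s
      using near[OF that] K(2) that
      by (auto simp: norm_mult norm_divide dist_norm norm_minus_commute divide_simps)
    show "bounded ((\<lambda>s. poly [:0, 1:] (1 / (s - w))) ` K)"
      using bounded_reciprocal_image[OF K(1,2)] by simp
  qed
  then show "(\<lambda>s. 1 / (s - w')) \<in> uniform_closure K (polynomials_with_pole w)"
  proof (rule uniform_closure_cong)
    fix s assume "s \<in> K"
    then have "s - w \<noteq> 0" "s - w' \<noteq> 0" using K by auto
    then show "poly [:0, 1:] (1 / (s - w)) / (1 - (w' - w) * (1 / (s - w))) = 1 / (s - w')"
      by (simp add: divide_simps)
  qed
qed

text \<open>
  Poles can be pushed inside a component of the complement: by the previous lemma, applied in both directions,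
  the closure is a locally constant function of the pole, hence constant on connected sets.
\<close>
lemma polynomials_with_pole_component:
  assumes K: "compact K" and C: "C \<in> components (- K)" "w \<in> C" "w' \<in> C"
  shows "uniform_closure K (polynomials_with_pole w) = uniform_closure K (polynomials_with_pole w')"
proof (rule connected_local_const[of C])
  show "connected C" using C in_components_connected by blast
  have sub: "C \<subseteq> - K" using C in_components_subset by blast
  show "\<forall>a\<in>C. eventually (\<lambda>b. uniform_closure K (polynomials_with_pole a) = uniform_closure K (polynomials_with_pole b)) (at a within C)"
  proof
    \<comment> \<open>If the ball of radius \<open>e\<close> about \<open>a\<close> misses \<open>K\<close> and \<open>b\<close> is within \<open>e / 3\<close> of \<open>a\<close>, then \<open>K\<close>
    is at distance at least \<open>2 * e / 3\<close> from \<open>b\<close> as well, so the situation is symmetric.\<close>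
    fix a assume a: "a \<in> C"
    then have "a \<in> - K" using sub by auto
    moreover have "open (- K)" using K compact_imp_closed by blast
    ultimately obtain e where e: "e > 0" "ball a e \<subseteq> - K" using openE by blast
    show "eventually (\<lambda>b. uniform_closure K (polynomials_with_pole a) = uniform_closure K (polynomials_with_pole b)) (at a within C)"
      unfolding eventually_at
    proof (intro exI[of _ "e / 3"] conjI ballI impI)
      fix b assume b: "b \<in> C" "b \<noteq> a \<and> dist b a < e / 3"
      have far: "2 * dist a b \<le> dist s a" "2 * dist b a \<le> dist s b" if "s \<in> K" for s
      proof -
        have "e \<le> dist s a" using e(2) that by (force simp: dist_commute)
        moreover have "dist a b < e / 3" "dist b a = dist a b" "0 \<le> dist a b"
          using b(2) by (auto simp: dist_commute)
        moreover have "dist s a \<le> dist s b + dist b a" by (rule dist_triangle)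
        ultimately show "2 * dist a b \<le> dist s a" "2 * dist b a \<le> dist s b" by linarith+
      qed
      have "a \<notin> K" "b \<notin> K" using a b(1) sub by auto
      then show "uniform_closure K (polynomials_with_pole a) = uniform_closure K (polynomials_with_pole b)"
        using far by (intro equalityI polynomials_with_pole_near K) auto
    qed (use e in auto)
  qed
qed (use C in auto)

text \<open>
  In an unbounded component the pole can be pushed outside a disc of twice the radius of one containing \<open>K\<close>,
  where \<open>1 / (s - v)\<close> is a geometric series in \<open>s\<close>.
\<close>
lemma polynomials_with_pole_unbounded:
  assumes K: "compact K" and C: "C \<in> components (- K)" "\<not> bounded C" "w \<in> C"
  shows "uniform_closure K (polynomials_with_pole w) \<subseteq> uniform_closure K (polynomials_in (\<lambda>s. s))"
proof -
  obtain B where B: "B > 0" "\<And>s. s \<in> K \<Longrightarrow> norm s \<le> B"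
    using compact_imp_bounded[OF K] by (auto simp: bounded_pos)
  obtain v where v: "v \<in> C" "norm v > 2 * B"
    using C(2) by (auto simp: bounded_iff not_le)
  have "v \<notin> K" using v(1) C(1) in_components_subset by blast
  have "v \<noteq> 0" using v B(1) by auto
  have "(\<lambda>s. poly [:- 1 / v:] s / (1 - 1 / v * s)) \<in> uniform_closure K (polynomials_in (\<lambda>s. s))"
  proof (rule geometric_in_uniform_closure)
    show "norm (1 / v * s) \<le> 1 / 2" if "s \<in> K" for s
      using B(2)[OF that] v(2) \<open>v \<noteq> 0\<close> by (simp add: norm_mult norm_divide divide_simps)
    show "bounded ((\<lambda>s. poly [:- 1 / v:] s) ` K)"
      by (auto simp: bounded_iff)
  qed
  then have "(\<lambda>s. 1 / (s - v)) \<in> uniform_closure K (polynomials_in (\<lambda>s. s))"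
  proof (rule uniform_closure_cong)
    fix s assume "s \<in> K"
    then have "s - v \<noteq> 0" "v - s \<noteq> 0" using \<open>v \<notin> K\<close> by auto
    then show "poly [:- 1 / v:] s / (1 - 1 / v * s) = 1 / (s - v)"
      using \<open>v \<noteq> 0\<close> by (simp add: divide_simps)
  qed
  then have "uniform_closure K (polynomials_with_pole v) \<subseteq> uniform_closure K (polynomials_in (\<lambda>s. s))"
    by (rule uniform_closure_polynomials_trans) (rule bounded_reciprocal_image[OF K \<open>v \<notin> K\<close>])
  then show ?thesis
    using polynomials_with_pole_component[OF K C(1,3) v(1)] by simp
qed

section \<open>Rational Dirichlet functions\<close>

lemma rational_dirichletI:
  fixes N :: nat
  assumes "\<And>j. j \<in> {1..N} \<Longrightarrow> z j \<in> A" "\<And>j. j \<in> {0..N} \<Longrightarrow> dirichlet_polynomial (P j)"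
    and "\<And>s. R s = P 0 s + (\<Sum>j=1..N. P j (1 / (s - z j)))"
  shows "R \<in> rational_dirichlet A"
  using assms unfolding rational_dirichlet_def by blast

lemma rational_dirichlet_mono: "A \<subseteq> B \<Longrightarrow> rational_dirichlet A \<subseteq> rational_dirichlet B"
  unfolding rational_dirichlet_def by blast

lemma dirichlet_polynomial_in_rational_dirichlet:
  "dirichlet_polynomial P \<Longrightarrow> P \<in> rational_dirichlet A"
  by (rule rational_dirichletI[of 0 _ _ "\<lambda>_. P"]) auto

lemma dirichlet_polynomial_pole_in_rational_dirichlet:
  "a \<in> A \<Longrightarrow> dirichlet_polynomial P \<Longrightarrow> (\<lambda>s. P (1 / (s - a))) \<in> rational_dirichlet A"
  by (rule rational_dirichletI[of 1 "\<lambda>_. a" _ "\<lambda>j. if j = 0 then \<lambda>_. 0 else P"])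
     (auto intro: dirichlet_polynomial_const)

lemma rational_dirichlet_add:
  assumes "R \<in> rational_dirichlet A" "R' \<in> rational_dirichlet A"
  shows "(\<lambda>s. R s + R' s) \<in> rational_dirichlet A"
proof -
  obtain N :: nat and z P where R: "\<And>j. j \<in> {1..N} \<Longrightarrow> z j \<in> A" "\<And>j. j \<in> {0..N} \<Longrightarrow> dirichlet_polynomial (P j)"
    "R = (\<lambda>s. P 0 s + (\<Sum>j=1..N. P j (1 / (s - z j))))"
    using assms(1) unfolding rational_dirichlet_def by blast
  obtain N' :: nat and z' P' where R': "\<And>j. j \<in> {1..N'} \<Longrightarrow> z' j \<in> A" "\<And>j. j \<in> {0..N'} \<Longrightarrow> dirichlet_polynomial (P' j)"
    "R' = (\<lambda>s. P' 0 s + (\<Sum>j=1..N'. P' j (1 / (s - z' j))))"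
    using assms(2) unfolding rational_dirichlet_def by blast
  define z'' where "z'' = (\<lambda>j. if j \<le> N then z j else z' (j - N))"
  define P'' where "P'' = (\<lambda>j. if j = 0 then \<lambda>s. P 0 s + P' 0 s else if j \<le> N then P j else P' (j - N))"
  show ?thesis
  proof (rule rational_dirichletI[of "N + N'" z'' A P''])
    show "z'' j \<in> A" if "j \<in> {1..N + N'}" for j
    proof (cases "j \<le> N")
      case False
      with that have "j - N \<in> {1..N'}" unfolding atLeastAtMost_iff by linarith
      from R'(1)[OF this] False show ?thesis by (simp add: z''_def)
    qed (use R(1)[of j] that in \<open>simp add: z''_def\<close>)
    show "dirichlet_polynomial (P'' j)" if "j \<in> {0..N + N'}" for j
      using R(2)[of j] R'(2)[of "j - N"] R(2)[of 0] R'(2)[of 0] that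
      by (auto simp: P''_def intro: dirichlet_polynomial_add)
    fix s
    have "{1..N + N'} = {1..N} \<union> (+) N ` {1..N'}"
      by (auto simp: image_iff)
    then have "(\<Sum>j=1..N + N'. P'' j (1 / (s - z'' j))) =
        (\<Sum>j=1..N. P'' j (1 / (s - z'' j))) + (\<Sum>j\<in>(+) N ` {1..N'}. P'' j (1 / (s - z'' j)))"
      by (simp only:) (rule sum.union_disjoint, auto)
    also have "(\<Sum>j\<in>(+) N ` {1..N'}. P'' j (1 / (s - z'' j))) = (\<Sum>j=1..N'. P' j (1 / (s - z' j)))"
      by (subst sum.reindex) (auto simp: P''_def z''_def intro!: sum.cong)
    also have "(\<Sum>j=1..N. P'' j (1 / (s - z'' j))) = (\<Sum>j=1..N. P j (1 / (s - z j)))"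
      by (intro sum.cong) (auto simp: P''_def z''_def)
    finally show "R s + R' s = P'' 0 s + (\<Sum>j=1..N + N'. P'' j (1 / (s - z'' j)))"
      unfolding R(3) R'(3) by (simp add: P''_def)
  qed
qed

lemma rational_dirichlet_cmult:
  assumes "R \<in> rational_dirichlet A"
  shows "(\<lambda>s. c * R s) \<in> rational_dirichlet A"
proof -
  obtain N :: nat and z P where R: "\<And>j. j \<in> {1..N} \<Longrightarrow> z j \<in> A" "\<And>j. j \<in> {0..N} \<Longrightarrow> dirichlet_polynomial (P j)"
    "R = (\<lambda>s. P 0 s + (\<Sum>j=1..N. P j (1 / (s - z j))))"
    using assms unfolding rational_dirichlet_def by blast
  show ?thesis
    by (rule rational_dirichletI[of N z A "\<lambda>j s. c * P j s"])
       (use R in \<open>auto simp: algebra_simps sum_distrib_left intro: dirichlet_polynomial_mult dirichlet_polynomial_const\<close>)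
qed

lemma holomorphic_on_rational_dirichlet:
  assumes "R \<in> rational_dirichlet A" "A \<inter> S = {}"
  shows "R holomorphic_on S"
proof -
  obtain N :: nat and z P where R: "\<And>j. j \<in> {1..N} \<Longrightarrow> z j \<in> A" "\<And>j. j \<in> {0..N} \<Longrightarrow> dirichlet_polynomial (P j)"
    "R = (\<lambda>s. P 0 s + (\<Sum>j=1..N. P j (1 / (s - z j))))"
    using assms(1) unfolding rational_dirichlet_def by blast
  have "(P j \<circ> (\<lambda>s. 1 / (s - z j))) holomorphic_on S" if j: "j \<in> {1..N}" for j
  proof (rule holomorphic_on_compose_gen[of _ _ _ UNIV])
    show "(\<lambda>s. 1 / (s - z j)) holomorphic_on S"
      using R(1)[OF j] assms(2) by (intro holomorphic_intros) auto
    show "P j holomorphic_on UNIV"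
      using R(2)[of j] j by (intro holomorphic_on_dirichlet_polynomial) auto
  qed auto
  then have "(\<lambda>s. \<Sum>j=1..N. P j (1 / (s - z j))) holomorphic_on S"
    unfolding o_def by (intro holomorphic_on_sum)
  then show ?thesis
    unfolding R(3) using R(2)[of 0]
    by (simp add: holomorphic_on_add holomorphic_on_dirichlet_polynomial)
qed

section \<open>Cauchy integrals over segments\<close>

lemma contour_integrable_Cauchy_kernel_linepath:
  assumes "continuous_on (closed_segment a b) f" "s \<notin> closed_segment a b"
  shows "(\<lambda>w. f w / (w - s)) contour_integrable_on linepath a b"
  using assms by (intro contour_integrable_continuous_linepath continuous_intros) auto

lemma continuous_on_Cauchy_integral_linepath:
  assumes "continuous_on (closed_segment a b) f"
  shows "continuous_on (- closed_segment a b) (\<lambda>s. contour_integral (linepath a b) (\<lambda>w. f w / (w - s)))"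
proof (rule continuous_at_imp_continuous_on, rule ballI)
  fix s assume s: "s \<in> - closed_segment a b"
  have "((\<lambda>s. contour_integral (linepath a b) (\<lambda>w. f w / (w - s))) has_field_derivative
      (of_nat 1 * contour_integral (linepath a b) (\<lambda>w. f w / (w - s) ^ Suc 1))) (at s)"
  proof (rule Cauchy_next_derivative(2)[where S = UNIV and B = "norm (b - a)"])
    fix w assume "w \<in> UNIV - path_image (linepath a b)"
    then show "((\<lambda>u. f u / (u - w) ^ 1) has_contour_integral
        contour_integral (linepath a b) (\<lambda>u. f u / (u - w))) (linepath a b)"
      using assms
      by (auto intro!: has_contour_integral_integral contour_integrable_Cauchy_kernel_linepath)
  qed (use assms s in auto)
  then show "isCont (\<lambda>s. contour_integral (linepath a b) (\<lambda>w. f w / (w - s))) s"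
    by (rule DERIV_isCont)
qed

text \<open>
  Stated with the oscillation bound \<open>e\<close> as a hypothesis, so that for an integrand depending on a parameter one
  subdivision serves all parameters at once.
\<close>
lemma left_Riemann_sum_error:
  fixes h :: "real \<Rightarrow> 'a::banach"
  assumes cont: "continuous_on {0..1} h" and n: "n > 0"
    and osc: "\<And>t t'. t \<in> {0..1} \<Longrightarrow> t' \<in> {0..1} \<Longrightarrow> \<bar>t - t'\<bar> \<le> 1 / real n \<Longrightarrow> norm (h t - h t') \<le> e"
  shows "norm (integral {0..1} h - (\<Sum>k<n. (1 / real n) *\<^sub>R h (real k / real n))) \<le> e"
proof -
  have "norm (integral {0..real m / real n} h - (\<Sum>k<m. (1 / real n) *\<^sub>R h (real k / real n))) \<le> real m / real n * e"
    if "m \<le> n" for m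
    using that
  proof (induction m)
    case (Suc m)
    let ?p = "real m / real n" and ?q = "real (Suc m) / real n"
    have pq: "0 \<le> ?p" "?p \<le> ?q" "?q \<le> 1" "?q - ?p = 1 / real n"
      using Suc.prems n by (auto simp: divide_simps)
    have mem: "t \<in> {0..1}" "?p \<in> {0..1}" "\<bar>t - ?p\<bar> \<le> 1 / real n" if "t \<in> {?p..?q}" for t
      unfolding atLeastAtMost_iff abs_le_iff using pq that[unfolded atLeastAtMost_iff] by linarith+
    have cont': "continuous_on {x..y} h" if "0 \<le> x" "y \<le> 1" for x y
      using cont by (rule continuous_on_subset) (use that in auto)
    have "integral {0..?q} h = integral {0..?p} h + integral {?p..?q} h"
      using pq by (intro Henstock_Kurzweil_Integration.integral_combine[symmetric]
          integrable_continuous_interval cont') auto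
    moreover have "integral {?p..?q} (\<lambda>t. h t - h ?p) = integral {?p..?q} h - (1 / real n) *\<^sub>R h ?p"
      using pq by (subst Henstock_Kurzweil_Integration.integral_diff)
        (auto intro!: integrable_continuous_interval cont')
    ultimately have "integral {0..?q} h - (\<Sum>k<Suc m. (1 / real n) *\<^sub>R h (real k / real n)) =
        (integral {0..?p} h - (\<Sum>k<m. (1 / real n) *\<^sub>R h (real k / real n))) +
        integral {?p..?q} (\<lambda>t. h t - h ?p)"
      by (simp only: sum.lessThan_Suc) (simp add: algebra_simps)
    moreover have "norm (integral {?p..?q} (\<lambda>t. h t - h ?p)) \<le> e * (?q - ?p)"
      using pq by (intro integral_bound continuous_intros cont' osc mem) auto
    ultimately have "norm (integral {0..?q} h - (\<Sum>k<Suc m. (1 / real n) *\<^sub>R h (real k / real n))) \<le>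
        ?p * e + e * (?q - ?p)"
      using Suc by (metis (no_types, lifting) Suc_leD add_mono norm_triangle_le)
    also have "\<dots> = ?q * e" by (simp add: algebra_simps)
    finally show ?case .
  qed auto
  from this[of n] n show ?thesis by simp
qed

text \<open>
  The integrand is uniformly continuous jointly in the position on the segment and in \<open>s \<in> K\<close>, so a Riemann
  sum converges uniformly on \<open>K\<close>. It is a linear combination of simple fractions with poles on the segment.
\<close>
lemma Cauchy_integral_linepath_approx:
  fixes f :: "complex \<Rightarrow> complex"
  assumes K: "compact K" and disj: "closed_segment a b \<inter> K = {}"
    and f: "continuous_on (closed_segment a b) f" and \<epsilon>: "\<epsilon> > 0"
  obtains n :: nat and c w where "\<And>k. k < n \<Longrightarrow> w k \<in> closed_segment a b"
    "\<And>s. s \<in> K \<Longrightarrow>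
       dist (\<Sum>k<n. c k * (1 / (s - w k))) (contour_integral (linepath a b) (\<lambda>w. f w / (w - s))) < \<epsilon>"
proof -
  define H where "H = (\<lambda>s t. f (linepath a b t) / (linepath a b t - s) * (b - a))"
  have seg: "linepath a b t \<in> closed_segment a b" if "t \<in> {0..1}" for t
    using that by (metis imageI path_image_def path_image_linepath)
  have contl: "continuous_on X (linepath a b)" for X
    by (rule continuous_on_linepath)
  have "continuous_on ({0..1} \<times> K) (\<lambda>(t, s). H s t)"
    unfolding H_def split_def
  proof (intro continuous_intros)
    show "continuous_on ({0..1} \<times> K) (\<lambda>p. linepath a b (fst p))"
      by (intro continuous_on_compose2[OF contl[of UNIV]] continuous_intros) auto
    show "continuous_on ({0..1} \<times> K) (\<lambda>p. f (linepath a b (fst p)))"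
      by (intro continuous_on_compose2[OF f] continuous_on_compose2[OF contl[of UNIV]] continuous_intros)
         (use seg in auto)
    show "\<forall>p\<in>{0..1} \<times> K. linepath a b (fst p) - snd p \<noteq> 0"
      using seg disj by force
  qed
  then have "uniformly_continuous_on ({0..1} \<times> K) (\<lambda>(t, s). H s t)"
    by (rule compact_uniformly_continuous) (intro compact_Times K compact_Icc)
  then obtain d where d: "d > 0" and
    osc: "\<And>p p'. p \<in> {0..1} \<times> K \<Longrightarrow> p' \<in> {0..1} \<times> K \<Longrightarrow> dist p' p < d \<Longrightarrow>
      dist ((\<lambda>(t, s). H s t) p') ((\<lambda>(t, s). H s t) p) < \<epsilon> / 2"
    unfolding uniformly_continuous_on_def using \<epsilon> by (meson half_gt_zero)
  obtain n where n: "1 / real (Suc n) < d"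
    using nat_approx_posE[OF d] by blast
  define w where "w = (\<lambda>k. linepath a b (real k / real (Suc n)))"
  \<comment> \<open>The sign turns \<open>1 / (w - s)\<close> into \<open>1 / (s - w)\<close>.\<close>
  define c where "c = (\<lambda>k. - (f (w k) * (b - a) / of_nat (Suc n)))"
  show thesis
  proof (rule that[of "Suc n" w c])
    show "w k \<in> closed_segment a b" if "k < Suc n" for k
      unfolding w_def using that by (intro seg) (auto simp: divide_simps)
    fix s assume s: "s \<in> K"
    have "norm (integral {0..1} (H s) - (\<Sum>k<Suc n. (1 / real (Suc n)) *\<^sub>R H s (real k / real (Suc n)))) \<le> \<epsilon> / 2"
    proof (rule left_Riemann_sum_error)
      show "continuous_on {0..1} (H s)"
        unfolding H_def
      proof (intro continuous_intros contl continuous_on_compose2[OF f contl])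
        show "\<forall>t\<in>{0..1}. linepath a b t - s \<noteq> 0"
          using seg disj s by fastforce
      qed (use seg in blast)
      fix t t' :: real assume "t \<in> {0..1}" "t' \<in> {0..1}" "\<bar>t - t'\<bar> \<le> 1 / real (Suc n)"
      then show "norm (H s t - H s t') \<le> \<epsilon> / 2"
        using osc[of "(t', s)" "(t, s)"] n s by (auto simp: dist_Pair_Pair dist_norm)
    qed auto
    moreover have "(1 / real (Suc n)) *\<^sub>R H s (real k / real (Suc n)) = c k * (1 / (s - w k))" if "k < Suc n" for k
    proof -
      have "w k \<noteq> s"
        using \<open>\<And>k. k < Suc n \<Longrightarrow> w k \<in> closed_segment a b\<close>[OF that] disj s by auto
      then have "w k - s \<noteq> 0" "s - w k \<noteq> 0" by auto
      have wk: "linepath a b (real k / real (Suc n)) = w k" by (simp only: w_def)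
      show ?thesis
        using \<open>w k - s \<noteq> 0\<close> \<open>s - w k \<noteq> 0\<close>
        unfolding H_def c_def wk scaleR_conv_of_real
        by (simp add: divide_simps del: of_nat_Suc) (simp add: algebra_simps)
    qed
    moreover have "integral {0..1} (H s) = contour_integral (linepath a b) (\<lambda>w. f w / (w - s))"
      by (simp add: contour_integral_integral H_def)
    ultimately show "dist (\<Sum>k<Suc n. c k * (1 / (s - w k)))
        (contour_integral (linepath a b) (\<lambda>w. f w / (w - s))) < \<epsilon>"
      using \<epsilon> by (simp add: dist_norm norm_minus_commute del: sum.lessThan_Suc of_nat_Suc)
  qed
qed

section \<open>A Cauchy formula for compact sets\<close>

lemma sum_diff_sets:
  fixes f :: "'a \<Rightarrow> 'b::ab_group_add"
  assumes "finite A" "finite B"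
  shows "sum f A - sum f B = sum f (A - B) - sum f (B - A)"
  using sum.Int_Diff[OF assms(1), of f B] sum.Int_Diff[OF assms(2), of f A]
  by (simp add: Int_commute)

lemma continuous_on_sum_mset [continuous_intros]:
  fixes F :: "'i \<Rightarrow> 'a::topological_space \<Rightarrow> 'b::topological_comm_monoid_add"
  assumes "\<And>i. i \<in># I \<Longrightarrow> continuous_on S (F i)"
  shows "continuous_on S (\<lambda>x. \<Sum>i\<in>#I. F i x)"
  using assms by (induction I) (auto intro!: continuous_intros)

lemma contour_integral_rectpath:
  assumes f: "continuous_on (path_image (rectpath a b)) f" and ab: "Re a \<le> Re b" "Im a \<le> Im b"
  defines "c \<equiv> Complex (Re b) (Im a)" and "d \<equiv> Complex (Re a) (Im b)"
  shows "contour_integral (rectpath a b) f =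
    contour_integral (linepath a c) f + contour_integral (linepath c b) f
    - contour_integral (linepath d b) f - contour_integral (linepath a d) f"
proof -
  have "closed_segment a c \<subseteq> path_image (rectpath a b)" "closed_segment c b \<subseteq> path_image (rectpath a b)"
    "closed_segment b d \<subseteq> path_image (rectpath a b)" "closed_segment d a \<subseteq> path_image (rectpath a b)"
    by (auto simp: rectpath_def Let_def path_image_join c_def d_def)
  then have cont: "continuous_on (closed_segment a c) f" "continuous_on (closed_segment c b) f"
    "continuous_on (closed_segment b d) f" "continuous_on (closed_segment d a) f"
    by (auto intro: continuous_on_subset[OF f])
  have "contour_integral (rectpath a b) f =
    contour_integral (linepath a c) f + (contour_integral (linepath c b) f
    + (contour_integral (linepath b d) f + contour_integral (linepath d a) f))"
    unfolding rectpath_def Let_def c_def[symmetric] d_def[symmetric]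
    using cont by (simp add: contour_integrable_continuous_linepath contour_integrable_join valid_path_join)
  then show ?thesis
    using contour_integral_reverse_linepath[OF cont(3)] contour_integral_reverse_linepath[OF cont(4)]
    by simp
qed

text \<open>
  The classical grid argument. Cover \<open>K\<close> by the closed cells of a square grid that meet it, with a mesh so fine
  that these cells lie in \<open>\<Omega>\<close>. For a point inside one of the cells the Cauchy formulas for all cells add up to
  \<open>2 * pi * \<i> * f s\<close>. Each edge shared by two of the cells is traversed in both directions and cancels; an
  edge that survives belongs to exactly one cell of the cover, so the neighbouring cell misses \<open>K\<close>, and
  with it the edge. Points of \<open>K\<close> on the grid lines are reached by continuity. The edges are kept as a multiset
  of oriented segments because the argument only ever sums over them; no closed curves are assembled.
\<close>
lemma Cauchy_formula_compact:
  assumes K: "compact K" and \<Omega>: "open \<Omega>" "K \<subseteq> \<Omega>" and f: "f holomorphic_on \<Omega>"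
  obtains E :: "(complex \<times> complex) multiset"
  where "\<And>a b. (a, b) \<in># E \<Longrightarrow> closed_segment a b \<subseteq> \<Omega> - K"
    "\<And>s. s \<in> K \<Longrightarrow> (\<Sum>(a, b)\<in>#E. contour_integral (linepath a b) (\<lambda>w. f w / (w - s))) = 2 * of_real pi * \<i> * f s"
proof -
  obtain e where e: "e > 0" "(\<Union>x\<in>K. cball x e) \<subseteq> \<Omega>"
    using compact_subset_open_imp_cball_epsilon_subset[OF K \<Omega>] by blast
  \<comment> \<open>Two points of a cell of side \<open>\<delta>\<close> differ by at most \<open>\<delta>\<close> in each coordinate, hence by at most \<open>2 * \<delta>\<close>.\<close>
  define \<delta> where "\<delta> = e / 2"
  have \<delta>: "\<delta> > 0" using e by (simp add: \<delta>_def)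
  define V :: "int \<Rightarrow> int \<Rightarrow> complex" where "V = (\<lambda>i j. Complex (\<delta> * of_int i) (\<delta> * of_int j))"
  define Q where "Q = (\<lambda>(i, j). cbox (V i j) (V (i + 1) (j + 1)))"
  define C where "C = {c. Q c \<inter> K \<noteq> {}}"
  have inQ: "x \<in> Q (i, j) \<longleftrightarrow> \<delta> * of_int i \<le> Re x \<and> Re x \<le> \<delta> * of_int (i + 1) \<and>
      \<delta> * of_int j \<le> Im x \<and> Im x \<le> \<delta> * of_int (j + 1)" for x i j
    by (auto simp: Q_def V_def in_cbox_complex_iff)
  have convQ: "convex (Q c)" for c by (cases c) (simp add: Q_def)
  have Q_sub: "Q c \<subseteq> \<Omega>" if cC: "c \<in> C" for c
  proof
    obtain i j where c: "c = (i, j)" by (cases c)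
    obtain x where x: "x \<in> Q c" "x \<in> K" using cC unfolding C_def by blast
    fix y assume y: "y \<in> Q c"
    have "\<bar>Re x - Re y\<bar> \<le> \<delta>" "\<bar>Im x - Im y\<bar> \<le> \<delta>"
      using x(1) y by (auto simp: c inQ algebra_simps)
    then have "norm (x - y) \<le> e"
      using cmod_le[of "x - y"] by (simp add: \<delta>_def)
    then have "y \<in> cball x e" by (simp add: dist_norm)
    then show "y \<in> \<Omega>" using e(2) x(2) by blast
  qed
  have finC: "finite C"
  proof -
    obtain B where B: "\<And>x. x \<in> K \<Longrightarrow> norm x \<le> B"
      using compact_imp_bounded[OF K] by (auto simp: bounded_iff)
    define n where "n = \<lceil>B / \<delta>\<rceil> + 1"
    have bnd: "i \<in> {-n..n}" if "\<delta> * of_int i \<le> t" "t \<le> \<delta> * of_int (i + 1)" "\<bar>t\<bar> \<le> B" for i t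
    proof -
      have "of_int i \<le> B / \<delta>" "- of_int i - 1 \<le> B / \<delta>"
        using that \<delta> by (auto simp: field_simps)
      then have "real_of_int i \<le> of_int \<lceil>B / \<delta>\<rceil>" "real_of_int (- i - 1) \<le> of_int \<lceil>B / \<delta>\<rceil>"
        using le_of_int_ceiling[of "B / \<delta>"] unfolding of_int_diff of_int_minus of_int_1 by linarith+
      then show ?thesis unfolding of_int_le_iff n_def by auto
    qed
    have "C \<subseteq> {-n..n} \<times> {-n..n}"
    proof
      fix c assume "c \<in> C"
      moreover obtain i j where c: "c = (i, j)" by (cases c)
      ultimately obtain x where x: "x \<in> Q (i, j)" "x \<in> K" by (auto simp: C_def)
      have "\<bar>Re x\<bar> \<le> B" "\<bar>Im x\<bar> \<le> B"
        using B[OF x(2)] abs_Re_le_cmod[of x] abs_Im_le_cmod[of x] by linarith+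
      with x(1) show "c \<in> {-n..n} \<times> {-n..n}"
        unfolding c inQ using bnd by blast
    qed
    then show ?thesis by (rule finite_subset) auto
  qed
  \<comment> \<open>Cell \<open>(i, j)\<close> has the horizontal edges \<open>(i, j)\<close> and \<open>(i, j + 1)\<close> and the vertical edges \<open>(i, j)\<close> and
  \<open>(i + 1, j)\<close>. Thus \<open>C\<close> and \<open>S\<close> index the lower and upper edges, \<open>C\<close> and \<open>T\<close> the left and right edges.\<close>
  define S T where "S = (\<lambda>(i, j). (i, j + 1)) ` C" and "T = (\<lambda>(i, j). (i + 1, j)) ` C"
  have inS: "(i, j) \<in> S \<longleftrightarrow> (i, j - 1) \<in> C" and inT: "(i, j) \<in> T \<longleftrightarrow> (i - 1, j) \<in> C" for i j
    by (force simp: S_def T_def)+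
  have finST: "finite S" "finite T" using finC by (auto simp: S_def T_def)
  define hs hr vs vr where "hs = (\<lambda>(i, j). (V i j, V (i + 1) j))" and "hr = (\<lambda>(i, j). (V (i + 1) j, V i j))"
    and "vs = (\<lambda>(i, j). (V i j, V i (j + 1)))" and "vr = (\<lambda>(i, j). (V i (j + 1), V i j))"
  \<comment> \<open>Counterclockwise boundaries: lower and right edges are kept in the positive direction, upper and
  left edges are reversed. The differences of index sets are the edges that survive cancellation.\<close>
  define E where "E = image_mset hs (mset_set (C - S)) + image_mset hr (mset_set (S - C)) +
      image_mset vs (mset_set (T - C)) + image_mset vr (mset_set (C - T))"
  have segh: "closed_segment (V i j) (V (i + 1) j) \<subseteq> Q (i, j) \<inter> Q (i, j - 1)"
    and segv: "closed_segment (V i j) (V i (j + 1)) \<subseteq> Q (i, j) \<inter> Q (i - 1, j)" for i j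
    using \<delta> by (intro closed_segment_subset convex_Int convQ; auto simp: inQ; simp add: V_def)+
  have off_cell: "s \<notin> Q c" if s: "s \<in> box (V i0 j0) (V (i0 + 1) (j0 + 1))" and c: "c \<noteq> (i0, j0)" for i0 j0 s c
  proof -
    have s': "\<delta> * of_int i0 < Re s" "Re s < \<delta> * of_int (i0 + 1)" "\<delta> * of_int j0 < Im s" "Im s < \<delta> * of_int (j0 + 1)"
      using s by (auto simp: in_box_complex_iff V_def)
    have between: "i = k" if "\<delta> * of_int k < t" "t < \<delta> * of_int (k + 1)" "\<delta> * of_int i \<le> t" "t \<le> \<delta> * of_int (i + 1)"
      for i k :: int and t
    proof -
      have "\<delta> * of_int k < \<delta> * of_int (i + 1)" "\<delta> * of_int i < \<delta> * of_int (k + 1)" using that by linarith+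
      then have "real_of_int k < of_int (i + 1)" "real_of_int i < of_int (k + 1)"
        using \<delta> by (simp_all only: mult_less_cancel_left_pos)
      then show ?thesis unfolding of_int_less_iff by linarith
    qed
    show ?thesis
      using c s' between by (cases c) (force simp: inQ)
  qed
  have off_h: "s \<notin> closed_segment (V i j) (V (i + 1) j)"
    and off_v: "s \<notin> closed_segment (V i j) (V i (j + 1))"
    if "s \<in> box (V i0 j0) (V (i0 + 1) (j0 + 1))" for i0 j0 s i j
    using segh[of i j] segv[of i j] off_cell[OF that, of "(i, j)"] off_cell[OF that, of "(i, j - 1)"]
      off_cell[OF that, of "(i - 1, j)"]
    by (cases "(i, j) = (i0, j0)"; auto)+
  have E_cases: thesis if ab: "(a, b) \<in># E"
    and seg_cases: "\<And>i j. closed_segment a b = closed_segment (V i j) (V (i + 1) j) \<Longrightarrow> (i, j) \<in> C - S \<or> (i, j) \<in> S - C \<Longrightarrow> thesis"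
    "\<And>i j. closed_segment a b = closed_segment (V i j) (V i (j + 1)) \<Longrightarrow> (i, j) \<in> T - C \<or> (i, j) \<in> C - T \<Longrightarrow> thesis"
    for a b thesis
  proof -
    consider i j where "(a, b) = hs (i, j)" "(i, j) \<in> C - S" | i j where "(a, b) = hr (i, j)" "(i, j) \<in> S - C"
      | i j where "(a, b) = vs (i, j)" "(i, j) \<in> T - C" | i j where "(a, b) = vr (i, j)" "(i, j) \<in> C - T"
      using ab finC finST by (auto simp: E_def)
    then show thesis
      by cases (use seg_cases in \<open>simp_all add: hs_def hr_def vs_def vr_def closed_segment_commute\<close>)
  qed
  have avoid: "X \<subseteq> \<Omega> - K" if "(c \<in> C) \<noteq> (d \<in> C)" "X \<subseteq> Q c \<inter> Q d" for c d X
  proof -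
    have "Q c \<inter> K = {} \<or> Q d \<inter> K = {}" "Q c \<subseteq> \<Omega> \<or> Q d \<subseteq> \<Omega>"
      using that(1) Q_sub[of c] Q_sub[of d] by (auto simp: C_def)
    with that(2) show ?thesis by blast
  qed
  have mem: "closed_segment a b \<subseteq> \<Omega> - K" if "(a, b) \<in># E" for a b
  proof -
    from that show ?thesis
    proof (rule E_cases)
      fix i j assume 1: "closed_segment a b = closed_segment (V i j) (V (i + 1) j)"
        "(i, j) \<in> C - S \<or> (i, j) \<in> S - C"
      show ?thesis
        by (rule avoid[OF _ segh[of i j, folded 1(1)]]) (use 1(2) in \<open>auto simp: inS\<close>)
    next
      fix i j assume 2: "closed_segment a b = closed_segment (V i j) (V i (j + 1))"
        "(i, j) \<in> T - C \<or> (i, j) \<in> C - T"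
      show ?thesis
        by (rule avoid[OF _ segv[of i j, folded 2(1)]]) (use 2(2) in \<open>auto simp: inT\<close>)
    qed
  qed
  define G where "G = (\<lambda>s. \<Sum>(a, b)\<in>#E. contour_integral (linepath a b) (\<lambda>w. f w / (w - s)))"
  have G_box: "G s = 2 * of_real pi * \<i> * f s"
    if c0: "(i0, j0) \<in> C" and s: "s \<in> box (V i0 j0) (V (i0 + 1) (j0 + 1))" for i0 j0 s
  proof -
    note s_notin = off_cell[OF s] and off_h = off_h[OF s] and off_v = off_v[OF s]
    let ?g = "\<lambda>w. f w / (w - s)"
    define h v where "h = (\<lambda>(i, j). contour_integral (linepath (V i j) (V (i + 1) j)) ?g)"
      and "v = (\<lambda>(i, j). contour_integral (linepath (V i j) (V i (j + 1))) ?g)"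
    have cell: "h (i, j) + v (i + 1, j) - h (i, j + 1) - v (i, j) =
        (if (i, j) = (i0, j0) then 2 * of_real pi * \<i> * f s else 0)" if c: "(i, j) \<in> C" for i j
    proof -
      let ?R = "rectpath (V i j) (V (i + 1) (j + 1))"
      have le: "Re (V i j) \<le> Re (V (i + 1) (j + 1))" "Im (V i j) \<le> Im (V (i + 1) (j + 1))"
        using \<delta> by (auto simp: V_def)
      have img: "path_image ?R \<subseteq> Q (i, j)"
        using path_image_rectpath_subset_cbox[OF le] by (simp add: Q_def)
      have notR: "s \<notin> path_image ?R"
        using s_notin[of "(i, j)"] img path_image_rectpath_inter_box[OF le] s by (cases "(i, j) = (i0, j0)") auto
      have "continuous_on (path_image ?R) ?g"
        using notR img Q_sub[OF c]
        by (intro continuous_intros continuous_on_subset[OF holomorphic_on_imp_continuous_on[OF f]]) auto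
      from contour_integral_rectpath[OF this le]
      have "h (i, j) + v (i + 1, j) - h (i, j + 1) - v (i, j) = contour_integral ?R ?g"
        by (simp add: h_def v_def) (simp add: V_def)
      also have "\<dots> = (if (i, j) = (i0, j0) then 2 * of_real pi * \<i> * f s else 0)"
      proof (cases "(i, j) = (i0, j0)")
        case True
        have "(?g has_contour_integral (2 * pi * \<i> * winding_number ?R s * f s)) ?R"
        proof (rule Cauchy_integral_formula_convex_simple[OF convQ[of "(i, j)"]])
          show "f holomorphic_on Q (i, j)" using f Q_sub[OF c] by (rule holomorphic_on_subset)
          show "s \<in> interior (Q (i, j))" using s True by (simp add: Q_def interior_cbox)
        qed (use img notR in auto)
        then show ?thesis
          using True s by (simp add: winding_number_rectpath contour_integral_unique)
      next
        case False
        have "(?g has_contour_integral 0) ?R"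
        proof (rule Cauchy_theorem_convex_simple[OF _ convQ[of "(i, j)"]])
          show "?g holomorphic_on Q (i, j)"
            using s_notin[OF False] Q_sub[OF c]
            by (intro holomorphic_intros holomorphic_on_subset[OF f]) auto
        qed (use img in auto)
        then show ?thesis using False by (auto simp: contour_integral_unique)
      qed
      finally show ?thesis .
    qed
    have rev: "contour_integral (linepath b a) ?g = - contour_integral (linepath a b) ?g"
      if "closed_segment a b \<subseteq> \<Omega> - {s}" for a b
      using that
      by (intro contour_integral_reverse_linepath continuous_intros
          continuous_on_subset[OF holomorphic_on_imp_continuous_on[OF f]])
         (auto simp: closed_segment_commute)
    have "G s = sum h (C - S) - sum h (S - C) + sum v (T - C) - sum v (C - T)"
    proof -
      have "G s = (\<Sum>(i, j)\<in>C - S. h (i, j)) + (\<Sum>(i, j)\<in>S - C. contour_integral (linepath (V (i + 1) j) (V i j)) ?g)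
          + (\<Sum>(i, j)\<in>T - C. v (i, j)) + (\<Sum>(i, j)\<in>C - T. contour_integral (linepath (V i (j + 1)) (V i j)) ?g)"
        by (simp add: G_def E_def sum_unfold_sum_mset image_mset.compositionality o_def split_def
            hs_def hr_def vs_def vr_def h_def v_def)
      also have "(\<Sum>(i, j)\<in>S - C. contour_integral (linepath (V (i + 1) j) (V i j)) ?g) = - sum h (S - C)"
        unfolding sum_negf[symmetric]
      proof (intro sum.cong refl, clarify)
        fix i j assume "(i, j) \<in> S" 
        then have "closed_segment (V i j) (V (i + 1) j) \<subseteq> \<Omega> - {s}"
          using segh[of i j] Q_sub[of "(i, j - 1)"] off_h[of i j] by (auto simp: inS)
        then show "contour_integral (linepath (V (i + 1) j) (V i j)) ?g = - h (i, j)"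
          unfolding h_def by (simp add: rev)
      qed
      also have "(\<Sum>(i, j)\<in>C - T. contour_integral (linepath (V i (j + 1)) (V i j)) ?g) = - sum v (C - T)"
        unfolding sum_negf[symmetric]
      proof (intro sum.cong refl, clarify)
        fix i j assume "(i, j) \<in> C" 
        then have "closed_segment (V i j) (V i (j + 1)) \<subseteq> \<Omega> - {s}"
          using segv[of i j] Q_sub[of "(i, j)"] off_v[of i j] by auto
        then show "contour_integral (linepath (V i (j + 1)) (V i j)) ?g = - v (i, j)"
          unfolding v_def by (simp add: rev)
      qed
      finally show ?thesis by simp
    qed
    \<comment> \<open>The cancelled edges are put back, in order to regroup the sum by cells.\<close>
    also have "\<dots> = (sum h C - sum h S) + (sum v T - sum v C)"
      using sum_diff_sets[OF finC finST(1), of h] sum_diff_sets[OF finST(2) finC, of v] by simp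
    also have "sum h S = (\<Sum>(i, j)\<in>C. h (i, j + 1))"
      unfolding S_def by (subst sum.reindex) (auto simp: inj_on_def o_def split_def)
    also have "sum v T = (\<Sum>(i, j)\<in>C. v (i + 1, j))"
      unfolding T_def by (subst sum.reindex) (auto simp: inj_on_def o_def split_def)
    also have "(sum h C - (\<Sum>(i, j)\<in>C. h (i, j + 1))) + ((\<Sum>(i, j)\<in>C. v (i + 1, j)) - sum v C) =
        (\<Sum>(i, j)\<in>C. h (i, j) + v (i + 1, j) - h (i, j + 1) - v (i, j))"
      by (simp add: split_def sum.distrib sum_subtractf)
    also have "\<dots> = (\<Sum>c\<in>C. if c = (i0, j0) then 2 * of_real pi * \<i> * f s else 0)"
      by (intro sum.cong refl) (clarsimp simp only: cell split: prod.split)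
    also have "\<dots> = 2 * of_real pi * \<i> * f s"
      using finC c0 by simp
    finally show ?thesis .
  qed
  \<comment> \<open>Both sides are continuous on \<open>U\<close>, which contains \<open>K\<close> and the interiors of all cells of the cover.\<close>
  define U where "U = \<Omega> - (\<Union>(a, b)\<in>set_mset E. closed_segment a b)"
  have contG: "continuous_on U G"
    unfolding G_def
  proof (rule continuous_on_sum_mset, clarify)
    fix a b assume ab: "(a, b) \<in># E"
    then have "continuous_on (closed_segment a b) f"
      using mem by (intro continuous_on_subset[OF holomorphic_on_imp_continuous_on[OF f]]) auto
    from continuous_on_subset[OF continuous_on_Cauchy_integral_linepath[OF this], of U]
    show "continuous_on U (\<lambda>s. contour_integral (linepath a b) (\<lambda>w. f w / (w - s)))"
      using ab by (force simp: U_def)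
  qed
  have contf: "continuous_on U f"
    by (rule continuous_on_subset[OF holomorphic_on_imp_continuous_on[OF f]]) (auto simp: U_def)
  have "closedin (top_of_set U) {s \<in> U. G s - 2 * of_real pi * \<i> * f s = 0}"
    by (intro continuous_closedin_preimage_constant continuous_intros contG contf)
  then obtain Z where Z: "closed Z" "{s \<in> U. G s - 2 * of_real pi * \<i> * f s = 0} = U \<inter> Z"
    by (auto simp: closedin_closed)
  show thesis
  proof (rule that[of E])
    show "closed_segment a b \<subseteq> \<Omega> - K" if "(a, b) \<in># E" for a b
      using mem that by blast
    fix s assume s: "s \<in> K"
    define i j where "i = \<lfloor>Re s / \<delta>\<rfloor>" and "j = \<lfloor>Im s / \<delta>\<rfloor>"
    have fl: "\<delta> * of_int \<lfloor>t / \<delta>\<rfloor> \<le> t" "t \<le> \<delta> * of_int (\<lfloor>t / \<delta>\<rfloor> + 1)" for t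
    proof -
      have "of_int \<lfloor>t / \<delta>\<rfloor> \<le> t / \<delta>" "t / \<delta> \<le> of_int (\<lfloor>t / \<delta>\<rfloor> + 1)"
        using floor_correct[of "t / \<delta>"] by linarith+
      then show "\<delta> * of_int \<lfloor>t / \<delta>\<rfloor> \<le> t" "t \<le> \<delta> * of_int (\<lfloor>t / \<delta>\<rfloor> + 1)"
        unfolding pos_le_divide_eq[OF \<delta>] pos_divide_le_eq[OF \<delta>] by (simp_all only: mult.commute)
    qed
    have sQ: "s \<in> Q (i, j)" unfolding inQ i_def j_def using fl by blast
    then have c: "(i, j) \<in> C" using s by (auto simp: C_def)
    let ?B = "box (V i j) (V (i + 1) (j + 1))"
    have "?B \<subseteq> U"
    proof
      fix x assume x: "x \<in> ?B"
      then have "x \<in> Q (i, j)" using box_subset_cbox by (auto simp: Q_def)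
      then have "x \<in> \<Omega>" using Q_sub[OF c] by auto
      moreover have "x \<notin> closed_segment a b" if "(a, b) \<in># E" for a b
        using that by (rule E_cases) (simp_all only: off_h[OF x] off_v[OF x] not_False_eq_True)
      ultimately show "x \<in> U" by (auto simp: U_def)
    qed
    then have "?B \<subseteq> Z" using G_box[OF c] Z(2) by auto
    then have "closure ?B \<subseteq> Z" using Z(1) by (rule closure_minimal)
    moreover have "?B \<noteq> {}" using \<delta> by (auto simp: box_ne_empty V_def Basis_complex_def)
    ultimately have "s \<in> Z" using sQ by (auto simp: Q_def closure_box)
    moreover have "s \<in> U" using s \<Omega>(2) mem by (auto simp: U_def)
    ultimately have "G s - 2 * of_real pi * \<i> * f s = 0" using Z(2) by auto
    then show "(\<Sum>(a, b)\<in>#E. contour_integral (linepath a b) (\<lambda>w. f w / (w - s))) = 2 * of_real pi * \<i> * f s"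
      by (simp add: G_def split_def)
  qed
qed

section \<open>Runge approximation by rational Dirichlet functions\<close>

text \<open>
  If \<open>w\<close> lies in a bounded component of the complement, its pole is pushed to a point of \<open>A\<close> in that component,
  otherwise to infinity. What results are polynomials in \<open>1 / (s - a)\<close> or in \<open>s\<close>, and these are replaced
  by Dirichlet polynomials in the same bounded quantity.
\<close>
lemma Cauchy_kernel_approx:
  assumes K: "compact K" and A: "\<And>C. C \<in> components (- K) \<Longrightarrow> bounded C \<Longrightarrow> A \<inter> C \<noteq> {}"
    and w: "w \<notin> K"
  shows "(\<lambda>s. 1 / (s - w)) \<in> uniform_closure K (rational_dirichlet A)"
proof -
  define C where "C = connected_component_set (- K) w"
  have C: "C \<in> components (- K)" "w \<in> C"
    using w by (auto simp: C_def componentsI)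
  have "(\<lambda>s. 1 / (s - w)) \<in> polynomials_with_pole w"
    by (auto simp: polynomials_in_def intro!: range_eqI[of _ _ "[:0, 1:]"])
  then have kernel: "(\<lambda>s. 1 / (s - w)) \<in> uniform_closure K (polynomials_with_pole w)"
    using subset_uniform_closure by blast
  show ?thesis
  proof (cases "bounded C")
    case True
    then obtain a where a: "a \<in> A" "a \<in> C" using A C(1) by blast
    then have "a \<notin> K" using C(1) in_components_subset by blast
    have "uniform_closure K (polynomials_with_pole w) = uniform_closure K (polynomials_with_pole a)"
      by (rule polynomials_with_pole_component[OF K C a(2)])
    also have "\<dots> \<subseteq> uniform_closure K {\<lambda>s. P (1 / (s - a)) |P. dirichlet_polynomial P}"
      by (rule polynomials_in_subset_dirichlet[OF bounded_reciprocal_image[OF K \<open>a \<notin> K\<close>]])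
    also have "\<dots> \<subseteq> uniform_closure K (rational_dirichlet A)"
      using dirichlet_polynomial_pole_in_rational_dirichlet[OF a(1)] subset_uniform_closure
      by (intro uniform_closure_minimal) blast
    finally show ?thesis using kernel by blast
  next
    case False
    have "uniform_closure K (polynomials_with_pole w) \<subseteq> uniform_closure K (polynomials_in (\<lambda>s. s))"
      by (rule polynomials_with_pole_unbounded[OF K C(1) False C(2)])
    also have "\<dots> \<subseteq> uniform_closure K {\<lambda>s. P s |P. dirichlet_polynomial P}"
      using compact_imp_bounded[OF K] by (intro polynomials_in_subset_dirichlet) simp
    also have "\<dots> \<subseteq> uniform_closure K (rational_dirichlet A)"
      using dirichlet_polynomial_in_rational_dirichlet subset_uniform_closure
      by (intro uniform_closure_minimal) blast
    finally show ?thesis using kernel by blast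
  qed
qed

text \<open>
  The Cauchy formula writes \<open>f\<close> as a sum of Cauchy integrals over segments off \<open>K\<close>, and these are uniform
  limits of combinations of the simple fractions treated in the previous lemma.
\<close>
proposition Runge_rational_dirichlet:
  assumes K: "compact K" and \<Omega>: "open \<Omega>" "K \<subseteq> \<Omega>" and f: "f holomorphic_on \<Omega>"
    and A: "\<And>C. C \<in> components (- K) \<Longrightarrow> bounded C \<Longrightarrow> A \<inter> C \<noteq> {}"
  shows "f \<in> uniform_closure K (rational_dirichlet A)"
proof -
  let ?X = "uniform_closure K (rational_dirichlet A)"
  note add = uniform_closure_add[of "rational_dirichlet A", OF rational_dirichlet_add]
  have zero: "(\<lambda>s. 0) \<in> ?X"
    using subset_uniform_closure dirichlet_polynomial_in_rational_dirichlet[OF dirichlet_polynomial_const]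
    by blast
  have cmult: "(\<lambda>s. c * g s) \<in> ?X" if g: "g \<in> ?X" for c g
  proof (cases "c = 0")
    case False
    show ?thesis
    proof (rule uniform_closureI)
      fix \<epsilon> :: real assume "\<epsilon> > 0"
      then have "\<epsilon> / norm c > 0" using False by simp
      then obtain h where h: "h \<in> rational_dirichlet A" "\<And>s. s \<in> K \<Longrightarrow> dist (h s) (g s) < \<epsilon> / norm c"
        using uniform_closureD[OF g] by blast
      have "dist (c * h s) (c * g s) < \<epsilon>" if "s \<in> K" for s
      proof -
        have "dist (c * h s) (c * g s) = norm c * dist (h s) (g s)"
          by (simp add: dist_norm flip: norm_mult right_diff_distrib)
        also have "\<dots> < norm c * (\<epsilon> / norm c)"
          using h(2)[OF that] False by (intro mult_strict_left_mono) auto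
        finally show ?thesis using False by simp
      qed
      then show "\<exists>h\<in>rational_dirichlet A. \<forall>s\<in>K. dist (h s) (c * g s) < \<epsilon>"
        using rational_dirichlet_cmult[OF h(1)] by (intro bexI) auto
    qed
  qed (use zero in simp)
  have sum: "(\<lambda>s. \<Sum>k<n. g k s) \<in> ?X" if "\<And>k. k < n \<Longrightarrow> g k \<in> ?X" for n :: nat and g
    using that by (induction n) (auto intro: zero add)
  have kernel: "(\<lambda>s. contour_integral (linepath a b) (\<lambda>w. f w / (w - s))) \<in> ?X"
    if ab: "closed_segment a b \<subseteq> \<Omega> - K" for a b
  proof (rule uniform_closure_closed)
    fix \<epsilon> :: real assume \<epsilon>: "\<epsilon> > 0"
    have cont: "continuous_on (closed_segment a b) f"
      using ab by (intro continuous_on_subset[OF holomorphic_on_imp_continuous_on[OF f]]) auto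
    have disj: "closed_segment a b \<inter> K = {}" using ab by auto
    show "\<exists>h\<in>?X. \<forall>s\<in>K. dist (h s) (contour_integral (linepath a b) (\<lambda>w. f w / (w - s))) < \<epsilon>"
    proof (rule Cauchy_integral_linepath_approx[OF K disj cont \<epsilon>], intro bexI ballI)
      fix n :: nat and c w s assume w: "\<And>k. k < n \<Longrightarrow> w k \<in> closed_segment a b"
      show "(\<lambda>s. \<Sum>k<n. c k * (1 / (s - w k))) \<in> ?X"
        using w disj by (intro sum cmult Cauchy_kernel_approx[OF K A]) auto
    qed
  qed
  obtain E where E: "\<And>a b. (a, b) \<in># E \<Longrightarrow> closed_segment a b \<subseteq> \<Omega> - K"
    and Cauchy: "\<And>s. s \<in> K \<Longrightarrow> (\<Sum>(a, b)\<in>#E. contour_integral (linepath a b) (\<lambda>w. f w / (w - s))) = 2 * of_real pi * \<i> * f s"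
    using Cauchy_formula_compact[OF K \<Omega> f] by blast
  have "(\<lambda>s. \<Sum>(a, b)\<in>#E. contour_integral (linepath a b) (\<lambda>w. f w / (w - s))) \<in> ?X"
    using E
  proof (induction E)
    case (add e E)
    then show ?case
      by (cases e) (auto intro!: uniform_closure_add[of "rational_dirichlet A", OF rational_dirichlet_add] kernel)
  qed (use zero in simp)
  from cmult[OF this, of "1 / (2 * of_real pi * \<i>)"] show ?thesis
    by (rule uniform_closure_cong) (simp add: Cauchy)
qed

theorem theorem4p5:
  fixes \<Omega> :: "complex set" and K A :: "nat \<Rightarrow> complex set" and AA :: "complex set"
  assumes "complex_domain \<Omega>"
    and "exhausting_family \<Omega> K"
    and "\<And>m. m \<ge> 1 \<Longrightarrow> \<exists>D. jordan_bounded_domain D \<and> K m = closure D"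
    and "\<And>m. m \<ge> 1 \<Longrightarrow> hole_representatives (K m) (A m)"
    and "AA = (\<Union>m\<in>{1..}. A m)"
  shows "(\<forall>f\<in>holomorphic_functions \<Omega>. \<forall>L \<epsilon>. compact L \<and> L \<subseteq> \<Omega> \<and> 0 < \<epsilon> \<longrightarrow>
            (\<exists>R\<in>rational_dirichlet (AA - L). \<forall>s\<in>L. dist (R s) (f s) < \<epsilon>)) \<and>
         (AA \<inter> \<Omega> = {} \<longrightarrow>
            (\<lambda>R. restrict R \<Omega>) ` rational_dirichlet AA \<subseteq> holomorphic_functions \<Omega> \<and>
            holomorphic_topology \<Omega> closure_of ((\<lambda>R. restrict R \<Omega>) ` rational_dirichlet AA)
              = topspace (holomorphic_topology \<Omega>))"
proof -
  have approx: "\<exists>R\<in>rational_dirichlet (AA - L). \<forall>s\<in>L. dist (R s) (f s) < \<epsilon>"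
    if f: "f \<in> holomorphic_functions \<Omega>" and L: "compact L" "L \<subseteq> \<Omega>" and \<epsilon>: "0 < \<epsilon>" for f L \<epsilon>
  proof -
    obtain m where m: "m \<ge> 1" "L \<subseteq> K m"
      using assms(2) L unfolding exhausting_family_def by blast
    have Km: "compact (K m)" "K m \<subseteq> \<Omega>"
      using assms(2) m(1) unfolding exhausting_family_def by blast+
    note holes = assms(4)[OF m(1), unfolded hole_representatives_def]
    have "A m \<inter> C \<noteq> {}" if "C \<in> components (- K m)" "bounded C" for C
      using holes that by blast
    then have "f \<in> uniform_closure (K m) (rational_dirichlet (A m))"
      using f assms(1) Km
      by (intro Runge_rational_dirichlet[of _ \<Omega>]) (auto simp: complex_domain_def holomorphic_functions_def)
    then obtain R where R: "R \<in> rational_dirichlet (A m)" "\<And>s. s \<in> K m \<Longrightarrow> dist (R s) (f s) < \<epsilon>"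
      using uniform_closureD[OF _ \<epsilon>] by blast
    \<comment> \<open>The poles avoid \<open>L\<close> because they lie in holes of \<open>K m\<close>, even when a hole is partly filled by \<open>\<Omega>\<close>.\<close>
    have "A m \<subseteq> - K m"
      using holes in_components_subset by blast
    then have "A m \<subseteq> AA - L"
      using m assms(5) by auto
    then have "R \<in> rational_dirichlet (AA - L)"
      using R(1) rational_dirichlet_mono by blast
    with R(2) m(2) show ?thesis by blast
  qed
  have hol: "(\<lambda>R. restrict R \<Omega>) ` rational_dirichlet AA \<subseteq> holomorphic_functions \<Omega>"
    if "AA \<inter> \<Omega> = {}"
    unfolding holomorphic_functions_def
    by (auto intro!: holomorphic_transform[OF holomorphic_on_rational_dirichlet[OF _ that]])
  have dense: "holomorphic_topology \<Omega> closure_of ((\<lambda>R. restrict R \<Omega>) ` rational_dirichlet AA)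
      = topspace (holomorphic_topology \<Omega>)" if disj: "AA \<inter> \<Omega> = {}"
  proof (rule subset_antisym[OF closure_of_subset_topspace], rule subsetI)
    fix f assume "f \<in> topspace (holomorphic_topology \<Omega>)"
    then have f: "f \<in> holomorphic_functions \<Omega>" by simp
    show "f \<in> holomorphic_topology \<Omega> closure_of ((\<lambda>R. restrict R \<Omega>) ` rational_dirichlet AA)"
      unfolding in_closure_of_holomorphic_topology
    proof (intro conjI allI impI f)
      fix L and \<epsilon> :: real assume L: "compact L \<and> L \<subseteq> \<Omega> \<and> 0 < \<epsilon>"
      then obtain R where R: "R \<in> rational_dirichlet (AA - L)" "\<And>s. s \<in> L \<Longrightarrow> dist (R s) (f s) < \<epsilon>"
        using approx[OF f, of L \<epsilon>] by blast
      have "R \<in> rational_dirichlet AA"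
        using R(1) rational_dirichlet_mono[of "AA - L" AA] by blast
      then have mem: "restrict R \<Omega> \<in> (\<lambda>R. restrict R \<Omega>) ` rational_dirichlet AA"
        by (rule imageI)
      then have "restrict R \<Omega> \<in> (\<lambda>R. restrict R \<Omega>) ` rational_dirichlet AA \<inter> holomorphic_functions \<Omega>"
        using hol[OF disj] by blast
      moreover have "\<forall>s\<in>L. dist (restrict R \<Omega> s) (f s) < \<epsilon>"
        using R(2) L by auto
      ultimately show "\<exists>g\<in>(\<lambda>R. restrict R \<Omega>) ` rational_dirichlet AA \<inter> holomorphic_functions \<Omega>.
          \<forall>s\<in>L. dist (g s) (f s) < \<epsilon>"
        by - (rule bexI[of _ "restrict R \<Omega>"])
    qed
  qed
  show ?thesis
    by (intro conjI ballI allI impI approx hol dense) auto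
qed

end
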